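(* Let $r\geqslant 2$ be an even integer, let $V$ be a $2r$-dimensional formed vector space over $\mathbb{F}_q$ of Witt index $r$, and let $G$ be the full semisimilarity group of $V$, acting on the set of all $\frac{r}{2}$-dimensional totally isotropic subspaces of $V$. Then $G$ is non-spreading.
   Context: A formed vector space is a finite-dimensional vector space over a finite field $\mathbb{F}_q$ equipped with a non-degenerate alternating form, a non-degenerate Hermitian form (in which case $q$ is a square), or a non-degenerate quadratic form. Dimension $2r$ with Witt index $r$ means that $V$ is symplectic, Hermitian of even dimension, or orthogonal of hyperbolic type. Totally isotropic means totally singular in the orthogonal case. The Witt index is the dimension of the maximal totally isotropic subspaces. All dimensions are vector space dimensions. Multisets on $\Omega$ are functions $\Omega\to\mathbb{Z}_{\ge 0}$ (multiplicities), sets are identified with characteristic functions, $|X|$ is the sum of multiplicities, and $(X\star Y)(i)=X(i)Y(i)$. A multiset (or set) is trivial if it is constant or only one element has nonzero multiplicity. A transitive permutation group $G$ on a finite set $\Omega$ (here, the permutation group induced by $G$) is non-spreading if there exist a nontrivial multiset $X$ and a nontrivial set $Y$ on $\Omega$ such that $|X|$ divides $|\Omega|$ and $|X\star Y^g|$ is constant for all $g\in G$. *)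

theory Defs
  imports Complex_Main "HOL-Algebra.Bij"
begin

section \<open>Formed vector spaces\<close>

text \<open>
  The whole type \<open>'v\<close> is the vector space, with scalar multiplication \<open>scale\<close> over the field
  \<open>'a\<close>. Sesquilinear forms are linear in the first argument.
\<close>

datatype ('a, 'v) form =
    Alternating "'v \<Rightarrow> 'v \<Rightarrow> 'a"
  | Hermitian "'v \<Rightarrow> 'v \<Rightarrow> 'a"
  | Quadratic "'v \<Rightarrow> 'a"

definition field_automorphism :: "('a::field \<Rightarrow> 'a) \<Rightarrow> bool" where
  "field_automorphism \<tau> \<longleftrightarrow>
     bij \<tau> \<and> \<tau> 1 = 1 \<and> (\<forall>x y. \<tau> (x + y) = \<tau> x + \<tau> y \<and> \<tau> (x * y) = \<tau> x * \<tau> y)"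

definition bilinear_form :: "('a::field \<Rightarrow> 'v::ab_group_add \<Rightarrow> 'v) \<Rightarrow> ('v \<Rightarrow> 'v \<Rightarrow> 'a) \<Rightarrow> bool" where
  "bilinear_form scale B \<longleftrightarrow>
     (\<forall>v. Vector_Spaces.linear scale (*) (\<lambda>u. B u v)) \<and>
     (\<forall>u. Vector_Spaces.linear scale (*) (B u))"

definition alternating_form :: "('a::field \<Rightarrow> 'v::ab_group_add \<Rightarrow> 'v) \<Rightarrow> ('v \<Rightarrow> 'v \<Rightarrow> 'a) \<Rightarrow> bool" where
  "alternating_form scale B \<longleftrightarrow> bilinear_form scale B \<and> (\<forall>v. B v v = 0)"

text \<open>
  A finite field has an automorphism of order two iff its order is a square \<open>q\<^sub>0\<^sup>2\<close>, and then the
  automorphism is \<open>x \<mapsto> x ^ q\<^sub>0\<close>. Semilinearity in the second argument is a consequence of the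
  two conditions on \<open>B\<close>.
\<close>

definition hermitian_form :: "('a::field \<Rightarrow> 'v::ab_group_add \<Rightarrow> 'v) \<Rightarrow> ('v \<Rightarrow> 'v \<Rightarrow> 'a) \<Rightarrow> bool" where
  "hermitian_form scale B \<longleftrightarrow>
     (\<exists>\<sigma>. field_automorphism \<sigma> \<and> \<sigma> \<noteq> id \<and> \<sigma> \<circ> \<sigma> = id \<and>
          (\<forall>v. Vector_Spaces.linear scale (*) (\<lambda>u. B u v)) \<and>
          (\<forall>u v. B v u = \<sigma> (B u v)))"

definition polar_form :: "('v::ab_group_add \<Rightarrow> 'a::field) \<Rightarrow> 'v \<Rightarrow> 'v \<Rightarrow> 'a" where
  "polar_form Q u v = Q (u + v) - Q u - Q v"

definition quadratic_form :: "('a::field \<Rightarrow> 'v::ab_group_add \<Rightarrow> 'v) \<Rightarrow> ('v \<Rightarrow> 'a) \<Rightarrow> bool" where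
  "quadratic_form scale Q \<longleftrightarrow>
     (\<forall>a v. Q (scale a v) = a\<^sup>2 * Q v) \<and> bilinear_form scale (polar_form Q)"

text \<open>
  In characteristic 2 the polar form of a non-degenerate quadratic form may have a radical,
  provided the radical contains no nonzero singular vector; over a finite field this only happens in odd dimension.
\<close>

fun nondegenerate :: "('a::field, 'v::ab_group_add) form \<Rightarrow> bool" where
  "nondegenerate (Alternating B) \<longleftrightarrow> (\<forall>u. (\<forall>v. B u v = 0) \<longrightarrow> u = 0)"
| "nondegenerate (Hermitian B) \<longleftrightarrow> (\<forall>u. (\<forall>v. B u v = 0) \<longrightarrow> u = 0)"
| "nondegenerate (Quadratic Q) \<longleftrightarrow> (\<forall>u. Q u = 0 \<and> (\<forall>v. polar_form Q u v = 0) \<longrightarrow> u = 0)"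

fun form_on :: "('a::field \<Rightarrow> 'v::ab_group_add \<Rightarrow> 'v) \<Rightarrow> ('a, 'v) form \<Rightarrow> bool" where
  "form_on scale (Alternating B) \<longleftrightarrow> alternating_form scale B"
| "form_on scale (Hermitian B) \<longleftrightarrow> hermitian_form scale B"
| "form_on scale (Quadratic Q) \<longleftrightarrow> quadratic_form scale Q"

definition formed_space ::
  "('a::{field,finite} \<Rightarrow> 'v::ab_group_add \<Rightarrow> 'v) \<Rightarrow> ('a, 'v) form \<Rightarrow> bool" where
  "formed_space scale F \<longleftrightarrow>
     vector_space scale \<and> (\<exists>S. finite S \<and> module.span scale S = UNIV) \<and>
     form_on scale F \<and> nondegenerate F"

fun vanishes_on :: "('a::field, 'v::ab_group_add) form \<Rightarrow> 'v set \<Rightarrow> bool" where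
  "vanishes_on (Alternating B) U \<longleftrightarrow> (\<forall>u\<in>U. \<forall>v\<in>U. B u v = 0)"
| "vanishes_on (Hermitian B) U \<longleftrightarrow> (\<forall>u\<in>U. \<forall>v\<in>U. B u v = 0)"
| "vanishes_on (Quadratic Q) U \<longleftrightarrow> (\<forall>u\<in>U. Q u = 0)"

definition totally_isotropic ::
  "('a::field \<Rightarrow> 'v::ab_group_add \<Rightarrow> 'v) \<Rightarrow> ('a, 'v) form \<Rightarrow> 'v set \<Rightarrow> bool" where
  "totally_isotropic scale F U \<longleftrightarrow> module.subspace scale U \<and> vanishes_on F U"

definition witt_index ::
  "('a::field \<Rightarrow> 'v::ab_group_add \<Rightarrow> 'v) \<Rightarrow> ('a, 'v) form \<Rightarrow> nat" where
  "witt_index scale F = Max {vector_space.dim scale U | U. totally_isotropic scale F U}"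

definition isotropic_subspaces ::
  "('a::field \<Rightarrow> 'v::ab_group_add \<Rightarrow> 'v) \<Rightarrow> ('a, 'v) form \<Rightarrow> nat \<Rightarrow> 'v set set" where
  "isotropic_subspaces scale F k =
     {U. totally_isotropic scale F U \<and> vector_space.dim scale U = k}"

fun scales_form ::
  "('a::field, 'v::ab_group_add) form \<Rightarrow> ('a \<Rightarrow> 'a) \<Rightarrow> 'a \<Rightarrow> ('v \<Rightarrow> 'v) \<Rightarrow> bool" where
  "scales_form (Alternating B) \<tau> c g \<longleftrightarrow> (\<forall>u v. B (g u) (g v) = c * \<tau> (B u v))"
| "scales_form (Hermitian B) \<tau> c g \<longleftrightarrow> (\<forall>u v. B (g u) (g v) = c * \<tau> (B u v))"
| "scales_form (Quadratic Q) \<tau> c g \<longleftrightarrow> (\<forall>v. Q (g v) = c * \<tau> (Q v))"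

definition semisimilarities ::
  "('a::field \<Rightarrow> 'v::ab_group_add \<Rightarrow> 'v) \<Rightarrow> ('a, 'v) form \<Rightarrow> ('v \<Rightarrow> 'v) set" where
  "semisimilarities scale F =
     {g. bij g \<and> (\<forall>u v. g (u + v) = g u + g v) \<and>
         (\<exists>\<tau> c. field_automorphism \<tau> \<and> c \<noteq> 0 \<and>
                (\<forall>a v. g (scale a v) = scale (\<tau> a) (g v)) \<and> scales_form F \<tau> c g)}"


section \<open>Non-spreading permutation groups\<close>

text \<open>
  A multiset on \<open>\<Omega>\<close> is a function to the naturals of which only the values on \<open>\<Omega>\<close> matter.
  A permutation group on \<open>\<Omega>\<close> is the set of its elements, which (as for \<^const>\<open>BijGroup\<close>) are
  extensional functions.
\<close>

definition multiset_card :: "'o set \<Rightarrow> ('o \<Rightarrow> nat) \<Rightarrow> nat" where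
  "multiset_card \<Omega> X = (\<Sum>i\<in>\<Omega>. X i)"

definition multiset_star :: "('o \<Rightarrow> nat) \<Rightarrow> ('o \<Rightarrow> nat) \<Rightarrow> 'o \<Rightarrow> nat" where
  "multiset_star X Y i = X i * Y i"

definition char_fun :: "'o set \<Rightarrow> 'o \<Rightarrow> nat" where
  "char_fun Y i = (if i \<in> Y then 1 else 0)"

definition trivial_multiset :: "'o set \<Rightarrow> ('o \<Rightarrow> nat) \<Rightarrow> bool" where
  "trivial_multiset \<Omega> X \<longleftrightarrow>
     (\<exists>c. \<forall>i\<in>\<Omega>. X i = c) \<or> (\<exists>!i. i \<in> \<Omega> \<and> X i \<noteq> 0)"

definition transitive_perm_group :: "'o set \<Rightarrow> ('o \<Rightarrow> 'o) set \<Rightarrow> bool" where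
  "transitive_perm_group \<Omega> P \<longleftrightarrow>
     subgroup P (BijGroup \<Omega>) \<and> (\<forall>x\<in>\<Omega>. \<forall>y\<in>\<Omega>. \<exists>g\<in>P. g x = y)"

definition non_spreading :: "'o set \<Rightarrow> ('o \<Rightarrow> 'o) set \<Rightarrow> bool" where
  "non_spreading \<Omega> P \<longleftrightarrow>
     finite \<Omega> \<and> transitive_perm_group \<Omega> P \<and>
     (\<exists>X Y. \<not> trivial_multiset \<Omega> X \<and>
            Y \<subseteq> \<Omega> \<and> \<not> trivial_multiset \<Omega> (char_fun Y) \<and>
            multiset_card \<Omega> X dvd card \<Omega> \<and>
            (\<exists>c. \<forall>g\<in>P. multiset_card \<Omega> (multiset_star X (char_fun (g ` Y))) = c))"

text \<open>The permutations of a set \<open>\<Omega>\<close> of subsets induced by a set \<open>G\<close> of maps on points.\<close>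

definition induced_on_subsets :: "'v set set \<Rightarrow> ('v \<Rightarrow> 'v) set \<Rightarrow> ('v set \<Rightarrow> 'v set) set" where
  "induced_on_subsets \<Omega> G = (\<lambda>g. restrict ((`) g) \<Omega>) ` G"

end

theory Submission
  imports Defs
begin

text \<open>
  Let \<open>k = r / 2\<close> and let \<open>e\<^sub>i, f\<^sub>i\<close> be a hyperbolic basis. The subspace \<open>W\<close> spanned by the first \<open>k\<close>
  hyperbolic pairs has the same dimension as its perp \<open>W'\<close>. As a maximal isotropic subspace \<open>M\<close> is its
  own perp, the duality \<open>dim M - dim (M \<inter> W') = dim W - dim (W \<inter> M)\<close> shows that \<open>M\<close> meets \<open>W\<close> and
  \<open>W'\<close> in equal dimensions. So if \<open>Y\<close> is the set of \<open>k\<close>-subspaces of \<open>M\<close>, and \<open>X\<close> has value 2 on the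
  isotropic \<open>k\<close>-subspaces of \<open>W\<close>, value 0 on those of \<open>W'\<close> and 1 elsewhere, then \<open>|X \<star> Y\<^sup>g| = |Y|\<close>
  for all \<open>g\<close>; and \<open>|X| = |\<Omega>|\<close> because an isometry swaps \<open>W\<close> and \<open>W'\<close>. Transitivity holds
  because every isotropic subspace is spanned by an initial part of some hyperbolic basis.
\<close>

section \<open>Polar spaces\<close>

text \<open>
  This covers the three kinds of forms at once: \<open>N\<close> is \<open>0\<close>, \<open>\<lambda>v. B v v\<close> or the quadratic form, whose
  polar form is \<open>B\<close>; correspondingly \<open>T x\<close> is \<open>0\<close>, \<open>x + \<sigma> x\<close> or \<open>x\<close>.
\<close>

locale polar_space = finite_dimensional_vector_space scale Basis
  for scale :: "'a::field \<Rightarrow> 'v::ab_group_add \<Rightarrow> 'v" (infixr "*s" 75) and Basis +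
  fixes B :: "'v \<Rightarrow> 'v \<Rightarrow> 'a" and N :: "'v \<Rightarrow> 'a"
    and \<sigma> T :: "'a \<Rightarrow> 'a" and \<epsilon> :: 'a
  assumes B_add_left: "B (u + v) w = B u w + B v w"
    and B_scale_left: "B (a *s u) w = a * B u w"
    and B_swap: "B v u = \<epsilon> * \<sigma> (B u v)"
    and \<sigma>_add: "\<sigma> (a + b) = \<sigma> a + \<sigma> b"
    and \<sigma>_mult: "\<sigma> (a * b) = \<sigma> a * \<sigma> b"
    and \<sigma>_one: "\<sigma> 1 = 1"
    and \<sigma>_invol: "\<sigma> (\<sigma> a) = a"
    and \<epsilon>_square: "\<epsilon> * \<epsilon> = 1"
    and N_add: "N (u + v) = N u + N v + T (B u v)"
    and N_scale: "N (a *s u) = a * \<sigma> a * N u"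
    and B_self: "N u = 0 \<Longrightarrow> B u u = 0"
    and T_surj: "\<exists>c. N u + T c = 0"
    and nondeg: "N u = 0 \<Longrightarrow> (\<And>v. B u v = 0) \<Longrightarrow> u = 0"
begin

lemma \<epsilon>_nonzero: "\<epsilon> \<noteq> 0"
  using \<epsilon>_square by auto

lemma \<sigma>_zero [simp]: "\<sigma> 0 = 0"
  using \<sigma>_add[of 0 0] by (metis add.right_neutral add_left_cancel)

lemma B_zero_left [simp]: "B 0 v = 0"
  using B_add_left[of 0 0 v] by (metis add.right_neutral add_left_cancel)

lemma B_zero_right [simp]: "B v 0 = 0"
  using B_swap[of v 0] by simp

lemma B_add_right: "B w (u + v) = B w u + B w v"
  by (simp add: B_swap[of w] B_add_left \<sigma>_add distrib_left)

lemma B_scale_right: "B w (a *s u) = \<sigma> a * B w u"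
  by (simp add: B_swap[of w] B_scale_left \<sigma>_mult mult_ac)

lemma B_zero_commute: "B u v = 0 \<longleftrightarrow> B v u = 0"
  by (metis B_swap \<sigma>_zero mult_zero_right)

lemma B_sum_left: "B (\<Sum>i\<in>I. x i) w = (\<Sum>i\<in>I. B (x i) w)"
  by (induction I rule: infinite_finite_induct) (auto simp: B_add_left)

lemma B_diff_left: "B (u - v) w = B u w - B v w"
  using B_add_left[of "u - v" v w] by simp

lemma N_zero [simp]: "N 0 = 0"
  using N_scale[of 0 0] by simp

lemma T_zero [simp]: "T 0 = 0"
  using N_add[of 0 0] by simp

section \<open>Orthogonal complements and their dimensions\<close>

definition perp :: "'v set \<Rightarrow> 'v set" where
  "perp S = {v. \<forall>s\<in>S. B v s = 0}"

lemma subspace_perp [simp]: "subspace (perp S)"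
  by (rule subspaceI) (auto simp: perp_def B_add_left B_scale_left)

lemma subset_perp_commute: "S \<subseteq> perp S' \<longleftrightarrow> S' \<subseteq> perp S"
  using B_zero_commute by (auto simp: perp_def)

lemma perp_span [simp]: "perp (span S) = perp S"
proof
  show "perp (span S) \<subseteq> perp S"
    using span_superset by (auto simp: perp_def)
  have "S \<subseteq> perp (perp S)"
    using subset_perp_commute by blast
  then have "span S \<subseteq> perp (perp S)"
    by (simp add: span_minimal)
  then show "perp S \<subseteq> perp (span S)"
    using subset_perp_commute by blast
qed

text \<open>The kernel of a linear functional has codimension at most one: if
  \<open>\<phi> t\<close> is nonzero, every \<open>v\<close> differs from a vector of the kernel by
  a multiple of \<open>t\<close>.\<close>

lemma dim_inter_kernel:
  assumes S: "subspace S"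
    and add: "\<And>u v. \<phi> (u + v) = \<phi> u + (\<phi> v :: 'a)" and sc: "\<And>a u. \<phi> (a *s u) = a * \<phi> u"
  shows "dim S \<le> dim (S \<inter> {v. \<phi> v = 0}) + 1"
proof (cases "S \<subseteq> {v. \<phi> v = 0}")
  case True
  then show ?thesis by (simp add: Int_absorb2)
next
  case False
  then obtain t where t: "t \<in> S" "\<phi> t \<noteq> 0" by auto
  have "S \<subseteq> span (insert t (S \<inter> {v. \<phi> v = 0}))"
  proof
    fix v assume v: "v \<in> S"
    have diff: "\<phi> (x - y) = \<phi> x - \<phi> y" for x y
      using add[of "x - y" y] by simp
    have "v - (\<phi> v / \<phi> t) *s t \<in> S \<inter> {v. \<phi> v = 0}"
      using t v S by (simp add: diff sc subspace_diff subspace_scale)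
    then show "v \<in> span (insert t (S \<inter> {v. \<phi> v = 0}))"
      unfolding span_insert by (blast intro: span_base)
  qed
  then have "dim S \<le> dim (insert t (S \<inter> {v. \<phi> v = 0}))"
    by (rule dim_mono)
  also have "\<dots> \<le> dim (S \<inter> {v. \<phi> v = 0}) + 1"
    by (simp add: dim_insert)
  finally show ?thesis .
qed

text \<open>Each vector of \<open>C\<close> imposes one linear condition on \<open>S\<close>, so
  this follows by induction on \<open>C\<close>.\<close>

lemma dim_inter_perp_card:
  assumes "finite C" "subspace S"
  shows "dim S \<le> dim (S \<inter> perp C) + card C"
  using assms(1)
proof induction
  case empty
  then show ?case by (simp add: perp_def)
next
  case (insert c C)
  have "dim (S \<inter> perp C) \<le> dim ((S \<inter> perp C) \<inter> {v. B v c = 0}) + 1"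
    by (rule dim_inter_kernel) (use assms in \<open>auto simp: subspace_inter B_add_left B_scale_left\<close>)
  moreover have "(S \<inter> perp C) \<inter> {v. B v c = 0} = S \<inter> perp (insert c C)"
    by (auto simp: perp_def)
  ultimately show ?case using insert by simp
qed

text \<open>Extend a basis \<open>C0\<close> of \<open>S \<inter> perp R\<close> to a basis
  \<open>C\<close> of \<open>S\<close>. The vectors of \<open>C0\<close> impose no condition on
  \<open>R\<close>, so \<open>R \<inter> perp S\<close> is cut out of \<open>R\<close> by the
  \<open>card C - card C0\<close> remaining ones.\<close>

lemma dim_inter_perp_le:
  assumes S: "subspace S" and R: "subspace R"
  shows "dim R + dim (S \<inter> perp R) \<le> dim (R \<inter> perp S) + dim S"
proof -
  obtain C0 where C0: "finite C0" "C0 \<subseteq> S \<inter> perp R" "independent C0"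
      "span C0 = S \<inter> perp R" "card C0 = dim (S \<inter> perp R)"
    using basis_subspace_exists[of "S \<inter> perp R"] S by (auto simp: subspace_inter)
  obtain C where C: "C0 \<subseteq> C" "C \<subseteq> S" "independent C" "S \<subseteq> span C"
    using maximal_independent_subset_extend[of C0 S] C0(2,3) by blast
  have fin: "finite C"
    using C(3) by (rule finiteI_independent)
  have card: "card C = dim S"
    using C by (intro basis_card_eq_dim)
  have "R \<inter> perp (C - C0) = R \<inter> perp C"
    using C0(2) C(1) B_zero_commute by (fastforce simp: perp_def)
  moreover have "perp C = perp S"
    using span_subspace[OF C(2,4) S] perp_span[of C] by simp
  ultimately have "R \<inter> perp (C - C0) = R \<inter> perp S" by simp
  then have "dim R \<le> dim (R \<inter> perp S) + card (C - C0)"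
    using dim_inter_perp_card[of "C - C0" R] fin R by simp
  moreover have "card (C - C0) + card C0 = card C"
    using fin C(1) by (simp add: card_Diff_subset card_mono finite_subset)
  ultimately show ?thesis
    using card C0(5) by simp
qed

text \<open>\<open>dim R - dim (R \<inter> perp S)\<close> is the rank of the pairing of \<open>R\<close> with \<open>S\<close>, hence symmetric.\<close>

lemma dim_inter_perp:
  assumes "subspace S" "subspace R"
  shows "dim R + dim (S \<inter> perp R) = dim (R \<inter> perp S) + dim S"
  using dim_inter_perp_le[of S R] dim_inter_perp_le[of R S] assms by simp

section \<open>Isotropic subspaces\<close>

definition isotropic :: "'v set \<Rightarrow> bool" where
  "isotropic U \<longleftrightarrow> subspace U \<and> (\<forall>u\<in>U. N u = 0) \<and> (\<forall>u\<in>U. \<forall>v\<in>U. B u v = 0)"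

lemma isotropic_subset: "isotropic U \<Longrightarrow> subspace U' \<Longrightarrow> U' \<subseteq> U \<Longrightarrow> isotropic U'"
  by (auto simp: isotropic_def)

lemma isotropic_span:
  assumes N: "\<And>x. x \<in> S \<Longrightarrow> N x = 0" and B: "\<And>x y. x \<in> S \<Longrightarrow> y \<in> S \<Longrightarrow> B x y = 0"
  shows "isotropic (span S)"
proof -
  have "S \<subseteq> perp S" using B by (auto simp: perp_def)
  then have "span S \<subseteq> perp (span S)"
    by (simp add: span_minimal)
  then have BS: "B u v = 0" if "u \<in> span S" "v \<in> span S" for u v
    using that by (auto simp: perp_def)
  \<comment> \<open>\<open>N\<close> is additive only up to \<open>T (B u v)\<close>. Membership in
    \<open>span S\<close> is carried through the induction so that \<open>BS\<close> makes this term
    vanish.\<close>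
  have "u \<in> span S \<and> N u = 0" if "u \<in> span S" for u
    using that
  proof (rule span_induct)
    show "subspace {u. u \<in> span S \<and> N u = 0}"
      by (rule subspaceI) (auto simp: span_zero span_add span_scale N_add N_scale BS)
  qed (auto simp: N span_base)
  then show ?thesis
    using BS by (auto simp: isotropic_def)
qed

end

section \<open>Hyperbolic bases\<close>

context polar_space
begin

lemma \<epsilon>_cancel: "\<epsilon> * (\<epsilon> * a) = a"
  by (simp add: \<epsilon>_square mult.assoc[symmetric])

text \<open>The last conjunct says that the vectors span, with coordinates read off by the form. The
  factor \<open>\<epsilon>\<close> appears because \<open>B (f i) (e i) = \<epsilon>\<close>, which
  is its own inverse.\<close>

definition hyperbolic :: "nat \<Rightarrow> (nat \<Rightarrow> 'v) \<Rightarrow> (nat \<Rightarrow> 'v) \<Rightarrow> bool" where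
  "hyperbolic r e f \<longleftrightarrow>
     (\<forall>i<r. N (e i) = 0 \<and> N (f i) = 0) \<and>
     (\<forall>i<r. \<forall>j<r. B (e i) (e j) = 0 \<and> B (f i) (f j) = 0 \<and> B (e i) (f j) = of_bool (i = j)) \<and>
     (\<forall>v. v = (\<Sum>i<r. B v (f i) *s e i) + (\<Sum>i<r. (\<epsilon> * B v (e i)) *s f i))"

text \<open>For a hyperbolic basis \<open>e\<close>, \<open>f\<close>, this is the linear map that
  sends each \<open>e i\<close> to \<open>e' i\<close> and each \<open>f i\<close> to
  \<open>f' i\<close>, written in coordinates.\<close>

definition transfer ::
  "nat \<Rightarrow> (nat \<Rightarrow> 'v) \<Rightarrow> (nat \<Rightarrow> 'v) \<Rightarrow> (nat \<Rightarrow> 'v) \<Rightarrow> (nat \<Rightarrow> 'v) \<Rightarrow> 'v \<Rightarrow> 'v" where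
  "transfer r e f e' f' v = (\<Sum>i<r. B v (f i) *s e' i) + (\<Sum>i<r. (\<epsilon> * B v (e i)) *s f' i)"

lemma hyperbolic_expand:
  "hyperbolic r e f \<Longrightarrow> v = (\<Sum>i<r. B v (f i) *s e i) + (\<Sum>i<r. (\<epsilon> * B v (e i)) *s f i)"
  unfolding hyperbolic_def by blast

lemma hyperbolic_dual:
  assumes "hyperbolic r e f" "i < r" "j < r"
  shows "B (f i) (e j) = \<epsilon> * of_bool (i = j)"
proof -
  have "B (e j) (f i) = of_bool (i = j)"
    using assms by (auto simp: hyperbolic_def)
  then show ?thesis
    by (simp add: B_swap[of "f i" "e j"] \<sigma>_one)
qed

lemma transfer_add: "transfer r e f e' f' (u + v) = transfer r e f e' f' u + transfer r e f e' f' v"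
  by (simp add: transfer_def B_add_left scale_left_distrib distrib_left sum.distrib)

lemma transfer_scale: "transfer r e f e' f' (a *s u) = a *s transfer r e f e' f' u"
  by (simp add: transfer_def B_scale_left scale_right_distrib scale_sum_right mult.left_commute)

lemma transfer_zero [simp]: "transfer r e f e' f' 0 = 0"
  using transfer_scale[of r e f e' f' 0 0] by simp

lemma transfer_sum: "transfer r e f e' f' (\<Sum>i\<in>I. x i) = (\<Sum>i\<in>I. transfer r e f e' f' (x i))"
  by (induction I rule: infinite_finite_induct) (auto simp: transfer_add)

lemma transfer_left:
  assumes "hyperbolic r e f" "j < r"
  shows "transfer r e f e' f' (e j) = e' j"
proof -
  have "(\<Sum>i<r. B (e j) (f i) *s e' i) = (\<Sum>i<r. if i = j then e' i else 0)"
    using assms by (intro sum.cong) (auto simp: hyperbolic_def)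
  moreover have "(\<Sum>i<r. (\<epsilon> * B (e j) (e i)) *s f' i) = 0"
    using assms by (intro sum.neutral) (auto simp: hyperbolic_def)
  ultimately show ?thesis
    using assms by (simp add: transfer_def)
qed

lemma transfer_right:
  assumes "hyperbolic r e f" "j < r"
  shows "transfer r e f e' f' (f j) = f' j"
proof -
  have "(\<Sum>i<r. (\<epsilon> * B (f j) (e i)) *s f' i) = (\<Sum>i<r. if i = j then f' i else 0)"
    using assms(2) \<epsilon>_square
    by (intro sum.cong) (auto simp: hyperbolic_dual[OF assms])
  moreover have "(\<Sum>i<r. B (f j) (f i) *s e' i) = 0"
    using assms by (intro sum.neutral) (auto simp: hyperbolic_def)
  ultimately show ?thesis
    using assms by (simp add: transfer_def)
qed

text \<open>Together with \<open>B_transfer_left\<close> this says that the image has the same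
  coordinates in the basis \<open>e'\<close>, \<open>f'\<close> as \<open>v\<close> has with respect
  to \<open>e\<close>, \<open>f\<close>. From this follow both the inverse of
  \<open>transfer\<close> and its isometry property.\<close>

lemma B_transfer_right:
  assumes "hyperbolic r e' f'" "j < r"
  shows "B (transfer r e f e' f' v) (f' j) = B v (f j)"
proof -
  have "(\<Sum>i<r. B v (f i) * B (e' i) (f' j)) = (\<Sum>i<r. if i = j then B v (f i) else 0)"
    using assms by (intro sum.cong) (auto simp: hyperbolic_def)
  moreover have "(\<Sum>i<r. \<epsilon> * B v (e i) * B (f' i) (f' j)) = 0"
    using assms by (intro sum.neutral) (auto simp: hyperbolic_def)
  ultimately show ?thesis
    using assms by (simp add: transfer_def B_add_left B_scale_left B_sum_left)
qed

lemma B_transfer_left: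
  assumes "hyperbolic r e' f'" "j < r"
  shows "B (transfer r e f e' f' v) (e' j) = B v (e j)"
proof -
  have "(\<Sum>i<r. \<epsilon> * B v (e i) * B (f' i) (e' j)) = (\<Sum>i<r. if i = j then B v (e i) else 0)"
    using assms(2) \<epsilon>_cancel
    by (intro sum.cong) (auto simp: hyperbolic_dual[OF assms(1) _ assms(2)] mult.commute)
  moreover have "(\<Sum>i<r. B v (f i) * B (e' i) (e' j)) = 0"
    using assms by (intro sum.neutral) (auto simp: hyperbolic_def)
  ultimately show ?thesis
    using assms by (simp add: transfer_def B_add_left B_scale_left B_sum_left)
qed

lemma transfer_transfer:
  assumes "hyperbolic r e f" "hyperbolic r e' f'"
  shows "transfer r e' f' e f (transfer r e f e' f' v) = v"
proof -
  have "transfer r e' f' e f (transfer r e f e' f' v)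
      = (\<Sum>i<r. B v (f i) *s e i) + (\<Sum>i<r. (\<epsilon> * B v (e i)) *s f i)"
    unfolding transfer_def[of r e' f' e f]
    using assms(2) by (simp add: B_transfer_left B_transfer_right)
  also have "\<dots> = v"
    by (rule hyperbolic_expand[OF assms(1), symmetric])
  finally show ?thesis .
qed

lemma bij_transfer:
  assumes "hyperbolic r e f" "hyperbolic r e' f'"
  shows "bij (transfer r e f e' f')"
  using transfer_transfer[OF assms] transfer_transfer[OF assms(2,1)]
  by (intro o_bij[of "transfer r e' f' e f"]) auto

text \<open>Only the left argument is expanded in coordinates. The right one is handled by the two
  preceding coordinate lemmas, turned around with \<open>B_swap\<close>, so no double sum
  arises.\<close>

lemma B_transfer:
  assumes "hyperbolic r e f" "hyperbolic r e' f'"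
  shows "B (transfer r e f e' f' u) (transfer r e f e' f' v) = B u v" (is "B (?g u) (?g v) = _")
proof -
  have f: "B (f' i) (?g v) = B (f i) v" and e: "B (e' i) (?g v) = B (e i) v" if "i < r" for i
    using B_transfer_left[OF assms(2) that, of e f v] B_transfer_right[OF assms(2) that, of e f v]
      B_swap[of "f' i" "?g v"] B_swap[of "f i" v] B_swap[of "e' i" "?g v"] B_swap[of "e i" v]
    by simp_all
  have "B (?g u) (?g v) = (\<Sum>i<r. B u (f i) * B (e' i) (?g v)) + (\<Sum>i<r. \<epsilon> * B u (e i) * B (f' i) (?g v))"
    by (subst (1) transfer_def) (simp add: B_add_left B_scale_left B_sum_left)
  also have "\<dots> = (\<Sum>i<r. B u (f i) * B (e i) v) + (\<Sum>i<r. \<epsilon> * B u (e i) * B (f i) v)"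
    by (simp add: f e)
  also have "\<dots> = B ((\<Sum>i<r. B u (f i) *s e i) + (\<Sum>i<r. (\<epsilon> * B u (e i)) *s f i)) v"
    by (simp add: B_add_left B_scale_left B_sum_left)
  also have "\<dots> = B u v"
    using hyperbolic_expand[OF assms(1), of u, symmetric] by (rule arg_cong)
  finally show ?thesis .
qed

lemma isotropic_hyperbolic:
  assumes "hyperbolic r e f" "I \<subseteq> {..<r}"
  shows "isotropic (span (e ` I))" "isotropic (span (f ` I))"
  using assms by (auto simp: hyperbolic_def subset_iff intro!: isotropic_span)

text \<open>Split \<open>u\<close> into its parts \<open>x\<close> and \<open>y\<close> in the spans
  of the \<open>e i\<close> and of the \<open>f i\<close>. Both spans are isotropic, so
  \<open>N u = T (B x y)\<close>, and the same holds for the images; thus invariance of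
  \<open>B\<close> suffices.\<close>

lemma N_transfer:
  assumes "hyperbolic r e f" "hyperbolic r e' f'"
  shows "N (transfer r e f e' f' u) = N u" (is "N (?g u) = _")
proof -
  define x where "x = (\<Sum>i<r. B u (f i) *s e i)"
  define y where "y = (\<Sum>i<r. (\<epsilon> * B u (e i)) *s f i)"
  have u: "u = x + y"
    unfolding x_def y_def by (rule hyperbolic_expand[OF assms(1)])
  have gx: "?g x = (\<Sum>i<r. B u (f i) *s e' i)"
    using assms by (simp add: x_def transfer_sum transfer_scale transfer_left)
  have gy: "?g y = (\<Sum>i<r. (\<epsilon> * B u (e i)) *s f' i)"
    using assms by (simp add: y_def transfer_sum transfer_scale transfer_right)
  have "x \<in> span (e ` {..<r})" "y \<in> span (f ` {..<r})"
    "?g x \<in> span (e' ` {..<r})" "?g y \<in> span (f' ` {..<r})"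
    unfolding gx gy unfolding x_def y_def by (auto intro!: span_sum intro: span_scale span_base)
  then have N0: "N x = 0" "N y = 0" "N (?g x) = 0" "N (?g y) = 0"
    using isotropic_hyperbolic[OF assms(1) order_refl] isotropic_hyperbolic[OF assms(2) order_refl]
    by (auto simp: isotropic_def)
  then show ?thesis
    by (simp add: u transfer_add N_add B_transfer[OF assms])
qed

section \<open>Isotropic subspaces of half the dimension\<close>

lemma perp_maximal:
  assumes M: "isotropic M" and dim: "dim UNIV = 2 * dim M"
  shows "perp M = M" "perp UNIV = {0}"
proof -
  have sM: "subspace M" using M by (simp add: isotropic_def)
  \<comment> \<open>\<open>nondeg\<close> only excludes radical vectors with \<open>N u = 0\<close>,
    so it is applied inside \<open>M\<close>, where \<open>N\<close> vanishes. Once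
    \<open>perp M = M\<close> is known, the whole radical lies in \<open>M\<close> and is
    zero.\<close>
  have "M \<inter> perp UNIV \<subseteq> {0}"
    using M nondeg by (auto simp: perp_def isotropic_def)
  then have "dim (M \<inter> perp UNIV) = 0" by simp
  then have "dim M = dim (perp M)"
    using dim_inter_perp[OF sM subspace_UNIV] dim by (simp del: dim_eq_0 dim_UNIV)
  moreover have "M \<subseteq> perp M"
    using M by (auto simp: isotropic_def perp_def)
  ultimately show eq: "perp M = M"
    using subspace_dim_equal[OF sM subspace_perp] by auto
  have "perp UNIV \<subseteq> perp M" by (auto simp: perp_def)
  with eq \<open>M \<inter> perp UNIV \<subseteq> {0}\<close> have "perp UNIV \<subseteq> {0}" by auto
  then show "perp UNIV = {0}" by (auto simp: perp_def)
qed

lemma dim_perp: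
  assumes "isotropic M" "dim UNIV = 2 * dim M" "subspace S"
  shows "dim S + dim (perp S) = dim UNIV"
  using dim_inter_perp[OF assms(3) subspace_UNIV] perp_maximal(2)[OF assms(1,2)]
    dim_eq_0[of "S \<inter> {0}"]
  by (simp del: dim_eq_0 dim_UNIV)

text \<open>The extension is \<open>U + (M \<inter> perp U)\<close>. Since
  \<open>perp M = M\<close>, the duality of dimensions shows that what \<open>M\<close> loses by
  intersecting with \<open>perp U\<close> is exactly what adding \<open>U\<close> restores.\<close>

lemma isotropic_extend:
  assumes M: "isotropic M" "dim UNIV = 2 * dim M" and U: "isotropic U"
  obtains M' where "isotropic M'" "U \<subseteq> M'" "dim M' = dim M"
proof
  have sub: "subspace M" "subspace U"
    using M U by (auto simp: isotropic_def)
  have UU: "U \<subseteq> perp U"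
    using U by (auto simp: isotropic_def perp_def)
  define R where "R = M \<inter> perp U"
  have R: "subspace R"
    using sub by (simp add: R_def subspace_inter)
  define S where "S = {x + y |x y. x \<in> U \<and> y \<in> R}"
  have S: "S = span (U \<union> R)"
    using sub R by (auto simp: S_def span_Un span_eq_iff[THEN iffD2])
  show "isotropic S"
    unfolding S
  proof (rule isotropic_span)
    fix x y assume "x \<in> U \<union> R" "y \<in> U \<union> R"
    then show "B x y = 0"
      using U M B_zero_commute by (auto simp: R_def isotropic_def perp_def)
  next
    fix x assume "x \<in> U \<union> R"
    then show "N x = 0"
      using U M by (auto simp: R_def isotropic_def)
  qed
  show "U \<subseteq> S"
    unfolding S using span_superset by blast
  have "dim U + dim R = dim (U \<inter> M) + dim M"
    using dim_inter_perp[OF sub] perp_maximal(1)[OF M]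
    by (simp add: R_def)
  moreover have "U \<inter> R = U \<inter> M"
    using UU by (auto simp: R_def)
  moreover have "dim S + dim (U \<inter> R) = dim U + dim R"
    unfolding S_def by (rule dim_sums_Int[OF sub(2) R])
  ultimately show "dim S = dim M" by simp
qed

section \<open>Existence of hyperbolic bases\<close>

lemma exists_dual_vector:
  assumes M: "isotropic M" "dim UNIV = 2 * r" "dim M = r"
    and e: "span (e ` {..<r}) = M" and j: "j < r"
  obtains g where "\<And>i. i < r \<Longrightarrow> B (e i) g = of_bool (i = j)"
proof -
  \<comment> \<open>Since \<open>dim S < r\<close>, its perp is too large to lie in
    \<open>M\<close>. A vector \<open>w\<close> of the perp outside \<open>M = perp M\<close> must
    pair nontrivially with the one remaining basis vector \<open>e j\<close>.\<close>
  define S where "S = span (e ` ({..<r} - {j}))"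
  have "dim S \<le> card (e ` ({..<r} - {j}))"
    unfolding S_def by (rule dim_le_card) auto
  also have "\<dots> \<le> card ({..<r} - {j})"
    by (rule card_image_le) auto
  finally have "dim S < r"
    using j by simp
  moreover have "dim S + dim (perp S) = 2 * r"
    using dim_perp[of M S] M by (simp add: S_def)
  ultimately have "\<not> perp S \<subseteq> M"
    using dim_subset[of "perp S" M] M(3) by linarith
  then obtain w where w: "w \<in> perp S" "w \<notin> M" by auto
  have perp: "B w (e i) = 0" if "i < r" "i \<noteq> j" for i
  proof -
    have "e i \<in> S"
      unfolding S_def using that by (intro span_base) auto
    then show ?thesis using w(1) by (auto simp: perp_def)
  qed
  have "B w (e j) \<noteq> 0"
  proof
    assume "B w (e j) = 0"
    with perp have "B w (e i) = 0" if "i < r" for i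
      using that by (cases "i = j") auto
    then have "w \<in> perp (span (e ` {..<r}))"
      unfolding perp_span by (auto simp: perp_def)
    moreover have "perp M = M"
      using perp_maximal(1)[of M] M by simp
    ultimately show False
      using e w(2) by simp
  qed
  then have nz: "B (e j) w \<noteq> 0"
    using B_zero_commute by blast
  show ?thesis
  proof (rule that)
    fix i assume "i < r"
    \<comment> \<open>The scalar is twisted by \<open>\<sigma>\<close> because \<open>B\<close> is
      only semilinear in its second argument.\<close>
    then show "B (e i) (\<sigma> (1 / B (e j) w) *s w) = of_bool (i = j)"
      using perp[of i] nz B_zero_commute[of "e i" w] by (auto simp: B_scale_right \<sigma>_invol)
  qed
qed

lemma hyperbolic_if_dual:
  assumes M: "isotropic M" "dim UNIV = 2 * r" "dim M = r"
    and e: "span (e ` {..<r}) = M"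
    and dual: "\<And>i j. i < r \<Longrightarrow> j < r \<Longrightarrow> B (e i) (f j) = of_bool (i = j)"
    and f: "\<And>i. i < r \<Longrightarrow> N (f i) = 0" "\<And>i j. i < r \<Longrightarrow> j < r \<Longrightarrow> B (f i) (f j) = 0"
  shows "hyperbolic r e f"
proof -
  have eM: "e i \<in> M" if "i < r" for i
    using that unfolding e[symmetric] by (intro span_base) auto
  have e0: "N (e i) = 0" "B (e i) (e j) = 0" if "i < r" "j < r" for i j
    using eM that M(1) by (auto simp: isotropic_def)
  have dual': "B (f j) (e i) = \<epsilon> * of_bool (i = j)" if "i < r" "j < r" for i j
    using dual[OF that] by (simp add: B_swap[of "f j" "e i"] \<sigma>_one)
  have coord: "x = (\<Sum>i<r. B x (f i) *s e i)" if "x \<in> M" for x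
    using that unfolding e[symmetric]
  proof (rule span_induct)
    show "subspace {x. x = (\<Sum>i<r. B x (f i) *s e i)}"
    proof (rule subspaceI; clarsimp)
      fix x y assume "x = (\<Sum>i<r. B x (f i) *s e i)" "y = (\<Sum>i<r. B y (f i) *s e i)"
      then show "x + y = (\<Sum>i<r. B (x + y) (f i) *s e i)"
        by (simp add: B_add_left scale_left_distrib sum.distrib)
    next
      fix c x assume "x = (\<Sum>i<r. B x (f i) *s e i)"
      then have "c *s x = c *s (\<Sum>i<r. B x (f i) *s e i)"
        by (rule arg_cong)
      also have "\<dots> = (\<Sum>i<r. B (c *s x) (f i) *s e i)"
        by (simp add: B_scale_left scale_sum_right)
      finally show "c *s x = (\<Sum>i<r. B (c *s x) (f i) *s e i)" .
    qed
    fix x assume "x \<in> e ` {..<r}"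
    then obtain j where j: "j < r" "x = e j" by auto
    have "(\<Sum>i<r. B (e j) (f i) *s e i) = (\<Sum>i<r. if i = j then e i else 0)"
      using j by (intro sum.cong) (auto simp: dual)
    then show "x = (\<Sum>i<r. B x (f i) *s e i)"
      using j by simp
  qed
  have "v = (\<Sum>i<r. B v (f i) *s e i) + (\<Sum>i<r. (\<epsilon> * B v (e i)) *s f i)" for v
  proof -
    \<comment> \<open>The error of the expansion is orthogonal to every \<open>e j\<close>, so it
      lies in \<open>perp M = M\<close>. There \<open>coord\<close> applies, and orthogonality to
      every \<open>f j\<close> makes it zero.\<close>
    define w where "w = v - ((\<Sum>i<r. B v (f i) *s e i) + (\<Sum>i<r. (\<epsilon> * B v (e i)) *s f i))"
    have "B w (e j) = 0" if "j < r" for j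
    proof -
      have "(\<Sum>i<r. \<epsilon> * B v (e i) * B (f i) (e j)) = (\<Sum>i<r. if i = j then B v (e i) else 0)"
        using that \<epsilon>_cancel by (intro sum.cong) (auto simp: dual' mult.commute)
      moreover have "(\<Sum>i<r. B v (f i) * B (e i) (e j)) = 0"
        using that by (intro sum.neutral) (auto simp: e0)
      ultimately show ?thesis
        using that by (simp add: w_def B_diff_left B_add_left B_sum_left B_scale_left)
    qed
    then have "w \<in> perp (span (e ` {..<r}))"
      unfolding perp_span by (auto simp: perp_def)
    then have "w \<in> M"
      using perp_maximal(1)[of M] M e by simp
    moreover have "B w (f j) = 0" if "j < r" for j
    proof -
      have "(\<Sum>i<r. B v (f i) * B (e i) (f j)) = (\<Sum>i<r. if i = j then B v (f i) else 0)"
        using that by (intro sum.cong) (auto simp: dual)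
      moreover have "(\<Sum>i<r. \<epsilon> * B v (e i) * B (f i) (f j)) = 0"
        using that by (intro sum.neutral) (auto simp: f)
      ultimately show ?thesis
        using that by (simp add: w_def B_diff_left B_add_left B_sum_left B_scale_left)
    qed
    ultimately have "w = 0"
      using coord[of w] by simp
    then show ?thesis
      by (simp add: w_def)
  qed
  then show ?thesis
    unfolding hyperbolic_def using e0 f dual by blast
qed

text \<open>Dual vectors \<open>g j\<close> need not be isotropic or mutually orthogonal. Adding an
  element \<open>h j\<close> of the isotropic space \<open>M\<close> keeps the duality with the
  \<open>e i\<close> and leaves enough freedom to correct both defects.\<close>

lemma exists_hyperbolic_extending:
  assumes M: "isotropic M" "dim UNIV = 2 * r" "dim M = r"
    and e: "span (e ` {..<r}) = M"
  obtains f where "hyperbolic r e f"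
proof -
  have "\<forall>j. \<exists>g. j < r \<longrightarrow> (\<forall>i<r. B (e i) g = of_bool (i = j))"
    using exists_dual_vector[OF M e] by metis
  then obtain g where g: "\<And>i j. i < r \<Longrightarrow> j < r \<Longrightarrow> B (e i) (g j) = of_bool (i = j)"
    by metis
  have "\<forall>j. \<exists>c. N (g j) + T c = 0"
    using T_surj by blast
  then obtain t where t: "\<And>j. N (g j) + T (t j) = 0"
    by metis
  \<comment> \<open>The correction is triangular: for \<open>j < i\<close> the entry
    \<open>c i j\<close> cancels \<open>B (g j) (g i)\<close> in \<open>B (f j) (f i)\<close>, while
    \<open>c j i = 0\<close> adds nothing. The diagonal entry is chosen so that
    \<open>B (g j) (h j) = t j\<close>, which gives \<open>N (f j) = 0\<close>.\<close>
  define c where "c i j = (if j < i then - B (g j) (g i) else if i = j then \<sigma> (t j * \<epsilon>) else 0)" for i j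
  define h where "h j = (\<Sum>i<r. c i j *s e i)" for j
  define f where "f j = g j + h j" for j
  have eM: "e i \<in> M" if "i < r" for i
    using that unfolding e[symmetric] by (intro span_base) auto
  have hM: "h j \<in> M" for j
    unfolding h_def using eM M(1) by (auto simp: isotropic_def intro!: subspace_sum subspace_scale)
  have hh: "N (h j) = 0" "B (h i) (h j) = 0" for i j
    using hM M(1) by (auto simp: isotropic_def)
  have eh: "B (e i) (h j) = 0" if "i < r" for i j
    using eM[OF that] hM M(1) by (auto simp: isotropic_def)
  have g': "B (g j) (e i) = \<epsilon> * of_bool (i = j)" if "i < r" "j < r" for i j
    using g[OF that] by (simp add: B_swap[of "g j" "e i"] \<sigma>_one)
  have hg: "B (h j) (g l) = c l j" if "l < r" for j l
  proof -
    have "B (h j) (g l) = (\<Sum>i<r. if i = l then c i j else 0)"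
      unfolding h_def B_sum_left B_scale_left using that by (intro sum.cong) (auto simp: g)
    then show ?thesis using that by simp
  qed
  have gh: "B (g j) (h l) = \<epsilon> * \<sigma> (c j l)" if "j < r" for j l
    using hg[OF that, of l] by (simp add: B_swap[of "g j" "h l"])
  have Nf: "N (f j) = 0" if "j < r" for j
  proof -
    have "\<epsilon> * \<sigma> (c j j) = t j"
      using \<epsilon>_cancel[of "t j"] by (simp add: c_def \<sigma>_invol mult.commute)
    then show ?thesis
      using t[of j] that by (simp add: f_def N_add hh gh)
  qed
  have less: "B (f j) (f l) = 0" if "j < r" "l < r" "j < l" for j l
    using that by (simp add: f_def B_add_left B_add_right hh gh hg c_def)
  have "B (f j) (f l) = 0" if "j < r" "l < r" for j l
    using less[of j l] less[of l j] that Nf[of j] B_self B_zero_commute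
    by (cases j l rule: linorder_cases) auto
  moreover have "B (e i) (f j) = of_bool (i = j)" if "i < r" "j < r" for i j
    using that by (simp add: f_def B_add_right g eh)
  ultimately have "hyperbolic r e f"
    using Nf by (intro hyperbolic_if_dual[OF M e])
  then show ?thesis by (rule that)
qed

text \<open>A basis of \<open>U\<close> is extended to one of a maximal isotropic subspace
  containing \<open>U\<close> and enumerated with the vectors of \<open>U\<close> first; the
  \<open>f i\<close> then come from the preceding lemma.\<close>

lemma exists_hyperbolic:
  assumes M: "isotropic M" "dim UNIV = 2 * r" "dim M = r" and U: "isotropic U"
  obtains e f where "hyperbolic r e f" "U = span (e ` {..<dim U})"
proof -
  obtain M' where M': "isotropic M'" "U \<subseteq> M'" "dim M' = r"
    using isotropic_extend[of M U] M U by auto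
  obtain C0 where C0: "finite C0" "C0 \<subseteq> U" "independent C0" "span C0 = U" "card C0 = dim U"
    using basis_subspace_exists[of U] U by (auto simp: isotropic_def)
  have "C0 \<subseteq> M'" using C0(2) M'(2) by blast
  then obtain C where C: "C0 \<subseteq> C" "C \<subseteq> M'" "independent C" "M' \<subseteq> span C"
    using maximal_independent_subset_extend[of C0 M'] C0(3) by blast
  have fin: "finite C" using C(3) by (rule finiteI_independent)
  have card: "card C = r"
    using C(2,4,3) M'(3) by (simp add: basis_card_eq_dim)
  obtain h0 where h0: "bij_betw h0 {0..<card C0} C0"
    using ex_bij_betw_nat_finite[OF C0(1)] by blast
  obtain h1 where h1: "bij_betw h1 {0..<card (C - C0)} (C - C0)"
    using ex_bij_betw_nat_finite[of "C - C0"] fin by blast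
  define e where "e i = (if i < dim U then h0 i else h1 (i - dim U))" for i
  have le: "dim U \<le> r"
    using dim_subset[OF M'(2)] M'(3) by simp
  have cardD: "card (C - C0) = r - dim U"
    using C(1) C0 card by (simp add: card_Diff_subset)
  have e0: "e ` {..<dim U} = C0"
  proof -
    have "e ` {..<dim U} = h0 ` {0..<card C0}"
      using C0(5) by (intro image_cong) (auto simp: e_def)
    then show ?thesis using h0 by (simp add: bij_betw_def)
  qed
  have e1: "e ` {dim U..<r} = C - C0"
  proof -
    have "{dim U..<r} = (\<lambda>i. i + dim U) ` {0..<r - dim U}"
      using le by simp
    then have "e ` {dim U..<r} = h1 ` {0..<r - dim U}"
      by (simp only: image_image) (simp add: e_def)
    then show ?thesis using h1 cardD by (simp add: bij_betw_def)
  qed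
  have "{..<r} = {..<dim U} \<union> {dim U..<r}"
    using le by auto
  then have "e ` {..<r} = C0 \<union> (C - C0)"
    by (simp only: image_Un e0 e1)
  then have "e ` {..<r} = C" using C(1) by blast
  then have span: "span (e ` {..<r}) = M'"
    using span_subspace[OF C(2,4)] M'(1) by (simp add: isotropic_def)
  obtain f where "hyperbolic r e f"
    using exists_hyperbolic_extending[OF M'(1) M(2) M'(3) span] by blast
  then show ?thesis
    using that e0 C0(4) by blast
qed

end

section \<open>The balanced weight function\<close>

text \<open>Restricting to \<open>\<Omega>\<close> is compatible with composition because
  \<open>\<Omega>\<close> is stable, so the closure properties of \<open>G\<close> carry over to the
  induced extensional functions.\<close>

lemma subgroup_induced_on_subsets:
  assumes bij: "\<And>g. g \<in> G \<Longrightarrow> bij g" and id: "id \<in> G"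
    and inv: "\<And>g. g \<in> G \<Longrightarrow> inv_into UNIV g \<in> G" and comp: "\<And>g h. g \<in> G \<Longrightarrow> h \<in> G \<Longrightarrow> g \<circ> h \<in> G"
    and stable: "\<And>g U. g \<in> G \<Longrightarrow> U \<in> \<Omega> \<Longrightarrow> g ` U \<in> \<Omega>"
  shows "subgroup (induced_on_subsets \<Omega> G) (BijGroup \<Omega>)"
proof -
  interpret group "BijGroup \<Omega>" by (rule group_BijGroup)
  define \<rho> where "\<rho> g = restrict ((`) g) \<Omega>" for g :: "'a \<Rightarrow> 'a"
  have inv_image: "inv_into UNIV g ` g ` U = U" "g ` inv_into UNIV g ` U = U" if "g \<in> G" for g U
    using bij[OF that] by (simp_all add: bij_is_inj bij_is_surj image_inv_f_f image_f_inv_f)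
  have Bij: "\<rho> g \<in> Bij \<Omega>" if "g \<in> G" for g
  proof -
    have "bij_betw (\<rho> g) \<Omega> \<Omega>"
      by (rule bij_betw_byWitness[of _ "\<rho> (inv_into UNIV g)"])
        (use that inv_image inv stable in \<open>auto simp: \<rho>_def\<close>)
    then show ?thesis by (simp add: Bij_def \<rho>_def)
  qed
  have mult: "\<rho> g \<otimes>\<^bsub>BijGroup \<Omega>\<^esub> \<rho> h = \<rho> (g \<circ> h)" if "g \<in> G" "h \<in> G" for g h
    using Bij[OF that(1)] Bij[OF that(2)] stable[OF that(2)]
    by (auto simp: BijGroup_def \<rho>_def compose_def fun_eq_iff image_comp)
  have one: "\<one>\<^bsub>BijGroup \<Omega>\<^esub> = \<rho> id"
    by (auto simp: BijGroup_def \<rho>_def fun_eq_iff)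
  show ?thesis
  proof (rule subgroupI)
    show "induced_on_subsets \<Omega> G \<subseteq> carrier (BijGroup \<Omega>)"
      using Bij by (auto simp: induced_on_subsets_def BijGroup_def \<rho>_def)
    show "induced_on_subsets \<Omega> G \<noteq> {}"
      using id by (auto simp: induced_on_subsets_def)
  next
    fix x assume "x \<in> induced_on_subsets \<Omega> G"
    then obtain g where g: "g \<in> G" "x = \<rho> g"
      by (auto simp: induced_on_subsets_def \<rho>_def)
    have "\<rho> (inv_into UNIV g) \<otimes>\<^bsub>BijGroup \<Omega>\<^esub> \<rho> g = \<one>\<^bsub>BijGroup \<Omega>\<^esub>"
      using mult[OF inv[OF g(1)] g(1)] bij[OF g(1)] one by (simp add: bij_is_inj)
    then have "inv\<^bsub>BijGroup \<Omega>\<^esub> x = \<rho> (inv_into UNIV g)"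
      using Bij[OF g(1)] Bij[OF inv[OF g(1)]] g(2)
      by (intro inv_equality) (auto simp: BijGroup_def)
    then show "inv\<^bsub>BijGroup \<Omega>\<^esub> x \<in> induced_on_subsets \<Omega> G"
      using inv[OF g(1)] by (auto simp: induced_on_subsets_def \<rho>_def)
  next
    fix x y assume "x \<in> induced_on_subsets \<Omega> G" "y \<in> induced_on_subsets \<Omega> G"
    then obtain g h where "g \<in> G" "x = \<rho> g" "h \<in> G" "y = \<rho> h"
      by (auto simp: induced_on_subsets_def \<rho>_def)
    then show "x \<otimes>\<^bsub>BijGroup \<Omega>\<^esub> y \<in> induced_on_subsets \<Omega> G"
      using mult comp by (auto simp: induced_on_subsets_def \<rho>_def)
  qed
qed

text \<open>Pointwise, the weight plus the indicator of \<open>A'\<close> equals 1 plus the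
  indicator of \<open>A\<close>. Adding instead of subtracting keeps the computation in the
  naturals.\<close>

lemma sum_balanced_weight:
  assumes "finite I" "A \<inter> A' = {}" "card (I \<inter> A) = card (I \<inter> A')"
  shows "(\<Sum>i\<in>I. if i \<in> A then 2 else if i \<in> A' then 0 else 1) = card I"
proof -
  let ?X = "\<lambda>i. if i \<in> A then 2 else if i \<in> A' then 0 else 1 :: nat"
  have "(\<Sum>i\<in>I. ?X i) + card (I \<inter> A') = (\<Sum>i\<in>I. ?X i + of_bool (i \<in> A'))"
    using assms(1) by (simp add: sum.distrib)
  also have "\<dots> = (\<Sum>i\<in>I. 1 + of_bool (i \<in> A))"
    using assms(2) by (intro sum.cong) auto
  also have "\<dots> = card I + card (I \<inter> A)"
    using assms(1) by (simp only: sum.distrib) simp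
  finally show ?thesis using assms(3) by simp
qed

section \<open>Counting subspaces of a fixed dimension\<close>

context finite_dimensional_vector_space
begin

lemma card_subspaces_eq:
  assumes S: "subspace S" "subspace S'" "dim S = dim S'"
  shows "card {U. subspace U \<and> U \<subseteq> S \<and> dim U = k} = card {U. subspace U \<and> U \<subseteq> S' \<and> dim U = k}"
proof -
  interpret p: finite_dimensional_vector_space_pair scale Basis scale Basis
    by unfold_locales
  obtain h where h: "Vector_Spaces.linear scale scale h" "h ` S = S'" "inj_on h S"
    using p.subspace_isomorphism[OF S] by blast
  interpret h: Vector_Spaces.linear scale scale h by (rule h(1))
  have dim: "dim (h ` U) = dim U" if "subspace U" "U \<subseteq> S" for U
    using that h(3) by (intro p.dim_image_eq h(1)) (auto simp: span_eq_iff[THEN iffD2] intro: inj_on_subset)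
  have "bij_betw ((`) h) {U. subspace U \<and> U \<subseteq> S \<and> dim U = k} {U. subspace U \<and> U \<subseteq> S' \<and> dim U = k}"
  proof (rule bij_betwI')
    fix U U' assume "U \<in> {U. subspace U \<and> U \<subseteq> S \<and> dim U = k}" "U' \<in> {U. subspace U \<and> U \<subseteq> S \<and> dim U = k}"
    then show "(h ` U = h ` U') = (U = U')"
      using inj_on_image_eq_iff[OF h(3)] by auto
  next
    fix U assume "U \<in> {U. subspace U \<and> U \<subseteq> S \<and> dim U = k}"
    then show "h ` U \<in> {U. subspace U \<and> U \<subseteq> S' \<and> dim U = k}"
      using dim h(2) h.subspace_image by auto
  next
    fix U assume U: "U \<in> {U. subspace U \<and> U \<subseteq> S' \<and> dim U = k}"
    \<comment> \<open>\<open>h\<close> is injective on \<open>S\<close> only, so the preimage has to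
      be cut down to \<open>S\<close>.\<close>
    define U' where "U' = S \<inter> h -` U"
    have "subspace U'" "U' \<subseteq> S"
      using U S(1) by (auto simp: U'_def subspace_inter h.subspace_vimage)
    moreover have "h ` U' = U"
      using U h(2) by (auto simp: U'_def)
    ultimately show "\<exists>U'\<in>{U. subspace U \<and> U \<subseteq> S \<and> dim U = k}. U = h ` U'"
      using U dim by auto
  qed
  then show ?thesis by (rule bij_betw_same_card)
qed

end

section \<open>Splitting a hyperbolic basis into two orthogonal halves\<close>

context polar_space
begin

lemma hyperbolic_permute:
  assumes h: "hyperbolic r e f" and \<pi>: "bij_betw \<pi> {..<r} {..<r}"
  shows "hyperbolic r (e \<circ> \<pi>) (f \<circ> \<pi>)"
proof -
  have lt: "\<pi> i < r" if "i < r" for i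
    using \<pi> that by (auto simp: bij_betw_def)
  have inj: "\<pi> i = \<pi> j \<longleftrightarrow> i = j" if "i < r" "j < r" for i j
    using \<pi> that by (auto simp: bij_betw_def inj_on_def)
  have "(\<Sum>i<r. B v (f (\<pi> i)) *s e (\<pi> i)) = (\<Sum>i<r. B v (f i) *s e i)"
    "(\<Sum>i<r. (\<epsilon> * B v (e (\<pi> i))) *s f (\<pi> i)) = (\<Sum>i<r. (\<epsilon> * B v (e i)) *s f i)" for v
    using sum.reindex_bij_betw[OF \<pi>, of "\<lambda>i. B v (f i) *s e i"]
      sum.reindex_bij_betw[OF \<pi>, of "\<lambda>i. (\<epsilon> * B v (e i)) *s f i"] by simp_all
  then have "v = (\<Sum>i<r. B v ((f \<circ> \<pi>) i) *s (e \<circ> \<pi>) i)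
      + (\<Sum>i<r. (\<epsilon> * B v ((e \<circ> \<pi>) i)) *s (f \<circ> \<pi>) i)" for v
    unfolding comp_def using hyperbolic_expand[OF h, of v] by metis
  moreover have "\<forall>i<r. N (e (\<pi> i)) = 0 \<and> N (f (\<pi> i)) = 0"
    using h lt unfolding hyperbolic_def by blast
  moreover have "\<forall>i<r. \<forall>j<r. B (e (\<pi> i)) (e (\<pi> j)) = 0 \<and> B (f (\<pi> i)) (f (\<pi> j)) = 0
      \<and> B (e (\<pi> i)) (f (\<pi> j)) = of_bool (\<pi> i = \<pi> j)"
    using h lt unfolding hyperbolic_def by blast
  ultimately show ?thesis
    using inj unfolding hyperbolic_def by auto
qed

text \<open>Pairing a linear relation among the \<open>x i\<close> with \<open>y j\<close> isolates
  the coefficient of \<open>x j\<close>, which proves independence.\<close>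

lemma dim_span_dual:
  assumes I: "finite I" and dual: "\<And>i j. i \<in> I \<Longrightarrow> j \<in> I \<Longrightarrow> B (x i) (y j) = (if i = j then d else 0)"
    and d: "d \<noteq> 0"
  shows "dim (span (x ` I)) = card I"
proof -
  have inj: "inj_on x I"
    using dual d by (metis inj_onI)
  have "independent (x ` I)"
  proof (rule independent_if_scalars_zero)
    fix c v assume c: "(\<Sum>w\<in>x ` I. c w *s w) = 0" and "v \<in> x ` I"
    then obtain j where j: "j \<in> I" "v = x j" by blast
    have "0 = B (\<Sum>i\<in>I. c (x i) *s x i) (y j)"
      using c by (simp add: sum.reindex[OF inj])
    also have "\<dots> = (\<Sum>i\<in>I. c (x i) * B (x i) (y j))"
      by (simp add: B_sum_left B_scale_left)
    also have "\<dots> = (\<Sum>i\<in>I. if i = j then c (x i) * d else 0)"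
      using j(1) by (intro sum.cong) (auto simp: dual)
    also have "\<dots> = c v * d"
      using I j by simp
    finally show "c v = 0" using d by simp
  qed (use I in simp)
  then show ?thesis
    by (simp add: dim_eq_card_independent card_image[OF inj])
qed

lemma dim_span_hyperbolic:
  assumes "hyperbolic r e f" "I \<subseteq> {..<r}"
  shows "dim (span (e ` I)) = card I" "dim (span (f ` I)) = card I"
proof -
  have I: "finite I" using assms(2) finite_subset by blast
  show "dim (span (e ` I)) = card I"
    by (rule dim_span_dual[of I e f 1]) (use assms I in \<open>auto simp: hyperbolic_def subset_iff\<close>)
  show "dim (span (f ` I)) = card I"
    by (rule dim_span_dual[of I f e \<epsilon>])
      (use assms I \<epsilon>_nonzero hyperbolic_dual[OF assms(1)] in \<open>auto simp: subset_iff\<close>)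
qed

text \<open>A vector orthogonal to all \<open>e i\<close> and \<open>f i\<close> with
  \<open>i\<close> in \<open>I\<close> has zero coordinates at the indices in \<open>I\<close>, so
  its expansion only involves the indices in \<open>J\<close>.\<close>

lemma perp_half:
  assumes h: "hyperbolic r e f" and I: "I \<union> J = {..<r}" "I \<inter> J = {}"
  shows "perp (span (e ` I \<union> f ` I)) = span (e ` J \<union> f ` J)"
proof
  have IJ: "i < r" "j < r" "i \<noteq> j" if "i \<in> I" "j \<in> J" for i j
    using I that by auto
  have "e ` J \<union> f ` J \<subseteq> perp (e ` I \<union> f ` I)"
  proof -
    have "B x y = 0" if xy: "x \<in> e ` J \<union> f ` J" "y \<in> e ` I \<union> f ` I" for x y
    proof -
      obtain i j where ij: "i \<in> I" "j \<in> J" "x = e j \<or> x = f j" "y = e i \<or> y = f i"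
        using xy by blast
      then have "B (e j) (e i) = 0" "B (f j) (f i) = 0" "B (e j) (f i) = 0" "B (f j) (e i) = 0"
        using h IJ[OF ij(1,2)] hyperbolic_dual[OF h, of j i] by (auto simp: hyperbolic_def)
      then show ?thesis using ij(3,4) by blast
    qed
    then show ?thesis by (auto simp: perp_def)
  qed
  then show "span (e ` J \<union> f ` J) \<subseteq> perp (span (e ` I \<union> f ` I))"
    by (simp add: span_minimal)
  show "perp (span (e ` I \<union> f ` I)) \<subseteq> span (e ` J \<union> f ` J)"
  proof
    fix v assume "v \<in> perp (span (e ` I \<union> f ` I))"
    then have v: "B v (e i) = 0" "B v (f i) = 0" if "i \<in> I" for i
      using that unfolding perp_span by (auto simp: perp_def)
    have "B v (f i) *s e i \<in> span (e ` J \<union> f ` J)" "(\<epsilon> * B v (e i)) *s f i \<in> span (e ` J \<union> f ` J)"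
      if "i < r" for i
    proof -
      have "i \<in> I \<or> e i \<in> span (e ` J \<union> f ` J) \<and> f i \<in> span (e ` J \<union> f ` J)"
        using that I by (auto intro: span_base)
      then show "B v (f i) *s e i \<in> span (e ` J \<union> f ` J)"
        "(\<epsilon> * B v (e i)) *s f i \<in> span (e ` J \<union> f ` J)"
        using v[of i] by (auto simp: span_zero intro: span_scale)
    qed
    then have "(\<Sum>i<r. B v (f i) *s e i) + (\<Sum>i<r. (\<epsilon> * B v (e i)) *s f i) \<in> span (e ` J \<union> f ` J)"
      by (intro span_add span_sum) auto
    then show "v \<in> span (e ` J \<union> f ` J)"
      using hyperbolic_expand[OF h, of v] by metis
  qed
qed

text \<open>By \<open>perp_half\<close> a common vector is orthogonal to both halves, hence to the
  whole basis, and all its coordinates vanish.\<close>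

lemma half_inter_perp:
  assumes h: "hyperbolic r e f" and I: "I \<union> J = {..<r}" "I \<inter> J = {}"
  shows "span (e ` I \<union> f ` I) \<inter> perp (span (e ` I \<union> f ` I)) = {0}"
proof -
  have "span (e ` I \<union> f ` I) = perp (span (e ` J \<union> f ` J))"
    using I by (intro perp_half[OF h, symmetric]) auto
  moreover have "v = 0"
    if "v \<in> perp (span (e ` J \<union> f ` J))" "v \<in> perp (span (e ` I \<union> f ` I))" for v
  proof -
    have "B v (e i) = 0" "B v (f i) = 0" if "i \<in> I \<union> J" for i
      using that \<open>v \<in> perp (span (e ` J \<union> f ` J))\<close> \<open>v \<in> perp (span (e ` I \<union> f ` I))\<close>
      unfolding perp_span by (auto simp: perp_def)
    then have "(\<Sum>i<r. B v (f i) *s e i) + (\<Sum>i<r. (\<epsilon> * B v (e i)) *s f i) = 0"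
      using I(1) by simp
    then show "v = 0"
      using hyperbolic_expand[OF h, of v] by (rule trans[rotated])
  qed
  moreover have "0 \<in> perp S" for S
    by (simp add: perp_def)
  ultimately show ?thesis by auto
qed

lemma transfer_span:
  "transfer r e f e' f' ` span S = span (transfer r e f e' f' ` S)"
proof -
  interpret t: Vector_Spaces.linear scale scale "transfer r e f e' f'"
    by unfold_locales (simp_all add: transfer_add transfer_scale)
  show ?thesis by (simp add: t.span_image)
qed

lemma dim_maximal_inter_perp:
  assumes M: "isotropic M" "dim UNIV = 2 * dim M" and W: "subspace W" "dim W = dim M"
  shows "dim (M \<inter> W) = dim (M \<inter> perp W)"
  using dim_inter_perp[of W M] M W perp_maximal(1)[OF M] by (auto simp: isotropic_def Int_commute)

end

text \<open>This isolates what the main argument needs from the semisimilarity group. The elements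
  need not be linear, only preserve isotropy and dimension, while every linear isometry must belong
  to \<open>G\<close>.\<close>

locale polar_space_group = polar_space scale Basis B N \<sigma> T \<epsilon>
  for scale :: "'a::field \<Rightarrow> 'v::ab_group_add \<Rightarrow> 'v" (infixr "*s" 75)
    and Basis B N \<sigma> T \<epsilon> +
  fixes G :: "('v \<Rightarrow> 'v) set"
  assumes bij: "g \<in> G \<Longrightarrow> bij g"
    and inv_mem: "g \<in> G \<Longrightarrow> inv_into UNIV g \<in> G"
    and comp_mem: "g \<in> G \<Longrightarrow> h \<in> G \<Longrightarrow> g \<circ> h \<in> G"
    and id_mem: "id \<in> G"
    and isotropic_image: "g \<in> G \<Longrightarrow> isotropic U \<Longrightarrow> isotropic (g ` U)"
    and dim_image: "g \<in> G \<Longrightarrow> dim (g ` U) = dim U"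
    and isometry_mem: "bij g \<Longrightarrow> (\<And>u v. g (u + v) = g u + g v) \<Longrightarrow> (\<And>a u. g (a *s u) = a *s g u)
      \<Longrightarrow> (\<And>u v. B (g u) (g v) = B u v) \<Longrightarrow> (\<And>u. N (g u) = N u) \<Longrightarrow> g \<in> G"
begin

definition isotropics :: "nat \<Rightarrow> 'v set set" where
  "isotropics k = {U. isotropic U \<and> dim U = k}"

lemma transfer_mem:
  "hyperbolic r e f \<Longrightarrow> hyperbolic r e' f' \<Longrightarrow> transfer r e f e' f' \<in> G"
  by (rule isometry_mem) (simp_all add: bij_transfer transfer_add transfer_scale B_transfer N_transfer)

text \<open>Used to describe the translates of the set \<open>Y\<close> and to see that an isometry
  exchanging two subspaces exchanges the families of isotropic subspaces inside them. The reverse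
  inclusion comes from the inverse of \<open>g\<close>.\<close>

lemma image_isotropics_below:
  assumes g: "g \<in> G"
  shows "(`) g ` {U \<in> isotropics k. U \<subseteq> S} = {U \<in> isotropics k. U \<subseteq> g ` S}"
proof
  show "(`) g ` {U \<in> isotropics k. U \<subseteq> S} \<subseteq> {U \<in> isotropics k. U \<subseteq> g ` S}"
    using isotropic_image[OF g] dim_image[OF g] by (auto simp: isotropics_def)
  show "{U \<in> isotropics k. U \<subseteq> g ` S} \<subseteq> (`) g ` {U \<in> isotropics k. U \<subseteq> S}"
  proof
    fix U assume U: "U \<in> {U \<in> isotropics k. U \<subseteq> g ` S}"
    define U' where "U' = inv_into UNIV g ` U"
    have "U = g ` U'"
      using bij[OF g] by (simp add: U'_def bij_is_surj image_f_inv_f)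
    moreover have "U' \<in> isotropics k"
      using U isotropic_image[OF inv_mem[OF g]] dim_image[OF inv_mem[OF g]]
      by (auto simp: isotropics_def U'_def)
    moreover have "U' \<subseteq> S"
      using U \<open>U = g ` U'\<close> inj_image_subset_iff[OF bij_is_inj[OF bij[OF g]], of U' S] by auto
    ultimately show "U \<in> (`) g ` {U \<in> isotropics k. U \<subseteq> S}"
      by blast
  qed
qed

lemma card_image_isotropics:
  assumes "g \<in> G"
  shows "card ((`) g ` \<U>) = card \<U>"
  using bij[OF assms] by (intro card_image inj_onI) (metis bij_is_inj inj_image_eq_iff)

lemma transitive_isotropics:
  assumes M: "isotropic M" "dim UNIV = 2 * dim M" and U: "U \<in> isotropics k" "U' \<in> isotropics k"
  obtains g where "g \<in> G" "g ` U = U'"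
proof -
  obtain e f where h: "hyperbolic (dim M) e f" "U = span (e ` {..<dim U})"
    using exists_hyperbolic[OF M refl, of U] U by (auto simp: isotropics_def)
  obtain e' f' where h': "hyperbolic (dim M) e' f'" "U' = span (e' ` {..<dim U'})"
    using exists_hyperbolic[OF M refl, of U'] U by (auto simp: isotropics_def)
  let ?g = "transfer (dim M) e f e' f'"
  have k: "dim U = k" "dim U' = k"
    using U by (auto simp: isotropics_def)
  obtain M' where "isotropic M'" "U \<subseteq> M'" "dim M' = dim M"
    using isotropic_extend[OF M, of U] U by (auto simp: isotropics_def)
  then have "k \<le> dim M"
    using dim_subset[of U M'] k by simp
  then have "?g ` e ` {..<k} = e' ` {..<k}"
    unfolding image_image using transfer_left[OF h(1)] k by (intro image_cong) auto
  then have "?g ` U = U'"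
    using h(2) h'(2) unfolding k by (simp add: transfer_span)
  then show ?thesis
    using that transfer_mem[OF h(1) h'(1)] by blast
qed

theorem non_spreading_isotropics:
  assumes fin: "finite (UNIV :: 'v set)" and k: "k > 0"
    and M: "isotropic M" "dim M = 2 * k" and dim: "dim UNIV = 2 * (2 * k)"
  shows "non_spreading (isotropics k) (induced_on_subsets (isotropics k) G)"
proof -
  let ?\<Omega> = "isotropics k"
  have finU: "finite \<U>" for \<U> :: "'v set set"
    by (rule finite_subset[OF _ finite_Pow_iff[THEN iffD2, OF fin]]) auto
  have dimM: "dim UNIV = 2 * dim M" using M(2) dim by simp
  have stable: "g ` U \<in> ?\<Omega>" if "g \<in> G" "U \<in> ?\<Omega>" for g U
    using that isotropic_image dim_image by (auto simp: isotropics_def)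
  have "transitive_perm_group ?\<Omega> (induced_on_subsets ?\<Omega> G)"
    unfolding transitive_perm_group_def
  proof (intro conjI ballI)
    show "subgroup (induced_on_subsets ?\<Omega> G) (BijGroup ?\<Omega>)"
      by (rule subgroup_induced_on_subsets)
        (use bij inv_mem comp_mem id_mem stable in auto)
    fix U U' assume U: "U \<in> ?\<Omega>" "U' \<in> ?\<Omega>"
    then obtain g where "g \<in> G" "g ` U = U'"
      using transitive_isotropics[OF M(1) dimM] by blast
    then show "\<exists>g\<in>induced_on_subsets ?\<Omega> G. g U = U'"
      using U by (force simp: induced_on_subsets_def)
  qed
  moreover
  obtain e f where h: "hyperbolic (2 * k) e f" and Me: "M = span (e ` {..<2 * k})"
    using exists_hyperbolic[OF M(1) dim M(2) M(1)] unfolding M(2) by blast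
  let ?I = "{..<k}" and ?J = "{k..<2 * k}"
  have sub: "?I \<subseteq> {..<2 * k}" "?J \<subseteq> {..<2 * k}" by auto
  have IJ: "?I \<union> ?J = {..<2 * k}" "?I \<inter> ?J = {}" by auto
  define W where "W = span (e ` ?I \<union> f ` ?I)"
  have sW: "subspace W" "subspace (perp W)" by (simp_all add: W_def)
  have Wperp: "perp W = span (e ` ?J \<union> f ` ?J)"
    unfolding W_def by (rule perp_half[OF h IJ])
  have Wzero: "W \<inter> perp W = {0}"
    unfolding W_def by (rule half_inter_perp[OF h IJ])
  \<comment> \<open>This involution exchanges the two halves of the index set. The corresponding
    isometry \<open>s\<close> exchanges \<open>W\<close> and \<open>perp W\<close>, which yields
    both \<open>dim W = 2 * k\<close> and \<open>card A = card A'\<close>.\<close>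
  define \<pi> where "\<pi> i = (if i < k then i + k else i - k)" for i
  have \<pi>: "bij_betw \<pi> {..<2 * k} {..<2 * k}"
    by (rule bij_betw_byWitness[of _ \<pi>]) (auto simp: \<pi>_def)
  define s where "s = transfer (2 * k) e f (e \<circ> \<pi>) (f \<circ> \<pi>)"
  have s: "s \<in> G"
    unfolding s_def by (rule transfer_mem[OF h hyperbolic_permute[OF h \<pi>]])
  have \<pi>I: "\<pi> ` ?I = ?J"
  proof -
    have "\<pi> ` ?I = (\<lambda>i. i + k) ` {0..<k}"
      by (auto simp: \<pi>_def atLeast0LessThan intro: image_cong)
    then show ?thesis by (simp add: mult_2)
  qed
  have "s ` e ` ?I = e ` \<pi> ` ?I" "s ` f ` ?I = f ` \<pi> ` ?I"
    unfolding image_image s_def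
    by (intro image_cong; simp add: transfer_left[OF h] transfer_right[OF h])+
  then have sWperp: "s ` W = perp W"
    unfolding W_def Wperp[unfolded W_def] s_def transfer_span by (simp add: image_Un \<pi>I)
  have dimW: "dim W = 2 * k"
    using dim_perp[OF M(1) dimM sW(1)] sWperp dim_image[OF s, of W] dim by simp

  define Y where "Y = {U \<in> ?\<Omega>. U \<subseteq> M}"
  define A where "A = {U \<in> ?\<Omega>. U \<subseteq> W}"
  define A' where "A' = {U \<in> ?\<Omega>. U \<subseteq> perp W}"
  define X where "X U = (if U \<in> A then 2 else if U \<in> A' then 0 else 1 :: nat)" for U
  \<comment> \<open>Here \<open>k > 0\<close> matters: only the zero subspace lies in both
    \<open>W\<close> and \<open>perp W\<close>.\<close>
  have disjoint: "A \<inter> A' = {}"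
  proof -
    have False if "U \<in> ?\<Omega>" "U \<subseteq> W \<inter> perp W" for U
      using that(2) k that(1) unfolding Wzero isotropics_def
      by (metis (mono_tags, lifting) dim_eq_0 less_irrefl mem_Collect_eq)
    then show ?thesis by (auto simp: A_def A'_def)
  qed
  have "(`) s ` A = A'"
    unfolding A_def A'_def image_isotropics_below[OF s] sWperp ..
  then have cardA: "card A = card A'"
    using card_image_isotropics[OF s, of A] by simp
  have "A \<subseteq> ?\<Omega>" "A' \<subseteq> ?\<Omega>" by (auto simp: A_def A'_def)
  then have sum\<Omega>: "multiset_card ?\<Omega> X = card ?\<Omega>"
    unfolding multiset_card_def X_def
    using cardA by (intro sum_balanced_weight finU disjoint) (simp add: Int_absorb1)
  have sumY: "multiset_card ?\<Omega> (multiset_star X (char_fun (p ` Y))) = card Y"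
    if p: "p \<in> induced_on_subsets ?\<Omega> G" for p
  proof -
    obtain g where g: "g \<in> G" "p = restrict ((`) g) ?\<Omega>"
      using p by (auto simp: induced_on_subsets_def)
    have "p ` Y = (`) g ` Y"
      using g(2) by (auto simp: Y_def)
    then have pY: "p ` Y = {U \<in> ?\<Omega>. U \<subseteq> g ` M}"
      using image_isotropics_below[OF g(1)] by (simp add: Y_def)
    have gM: "isotropic (g ` M)" "dim (g ` M) = 2 * k"
      using isotropic_image[OF g(1) M(1)] dim_image[OF g(1)] M(2) by auto
    \<comment> \<open>All subspaces of the isotropic space \<open>g\<close>
      M\<open>are isotropic, so counting members of\<close>?\<Omega>\<open>inside\<close>g
      \<open>M \<inter> S\<close> is counting all its \<open>k\<close>-subspaces. That number
      depends only on the dimension of the intersection.\<close>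
    have below: "{U \<in> ?\<Omega>. U \<subseteq> g ` M \<and> U \<subseteq> S} = {U. subspace U \<and> U \<subseteq> g ` M \<inter> S \<and> dim U = k}" for S
      using isotropic_subset[OF gM(1)] by (auto simp: isotropics_def isotropic_def)
    have "card {U. subspace U \<and> U \<subseteq> g ` M \<inter> W \<and> dim U = k}
        = card {U. subspace U \<and> U \<subseteq> g ` M \<inter> perp W \<and> dim U = k}"
      using gM(1) sW dim_maximal_inter_perp[OF gM(1) _ sW(1)] gM(2) dimW dim
      by (intro card_subspaces_eq) (auto simp: isotropic_def subspace_inter)
    then have "card (p ` Y \<inter> A) = card (p ` Y \<inter> A')"
      unfolding below[symmetric] by (simp add: pY A_def A'_def Int_def conj_ac)
    then have "(\<Sum>U\<in>p ` Y. X U) = card (p ` Y)"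
      unfolding X_def by (intro sum_balanced_weight finU disjoint)
    moreover have "multiset_card ?\<Omega> (multiset_star X (char_fun (p ` Y))) = (\<Sum>U\<in>?\<Omega> \<inter> p ` Y. X U)"
      unfolding multiset_card_def sum.inter_restrict[OF finU]
      by (intro sum.cong) (auto simp: multiset_star_def char_fun_def)
    moreover have "?\<Omega> \<inter> p ` Y = p ` Y"
      unfolding pY by auto
    ultimately show ?thesis
      using \<open>p ` Y = (`) g ` Y\<close> card_image_isotropics[OF g(1)] by simp
  qed
  \<comment> \<open>Witnesses for nontriviality: \<open>U1\<close> lies in \<open>A\<close> and
    \<open>Y\<close>, \<open>U2\<close> in \<open>A'\<close> and \<open>Y\<close>, and
    \<open>U3\<close> in \<open>A\<close> but not in \<open>Y\<close>. Hence \<open>X\<close> takes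
    the values 2, 0, 2 on them and \<open>char_fun Y\<close> the values 1, 1, 0, which excludes
    constancy as well as a single nonzero value.\<close>
  define U1 where "U1 = span (e ` ?I)"
  define U2 where "U2 = span (e ` ?J)"
  define U3 where "U3 = span (f ` ?I)"
  have U\<Omega>: "U1 \<in> ?\<Omega>" "U2 \<in> ?\<Omega>" "U3 \<in> ?\<Omega>"
    unfolding U1_def U2_def U3_def isotropics_def
    using isotropic_hyperbolic[OF h sub(1)] isotropic_hyperbolic[OF h sub(2)]
      dim_span_hyperbolic[OF h sub(1)] dim_span_hyperbolic[OF h sub(2)] by auto
  have "U1 \<subseteq> W" "U3 \<subseteq> W" "U2 \<subseteq> perp W" "U1 \<subseteq> M" "U2 \<subseteq> M"
    unfolding U1_def U2_def U3_def Wperp Me unfolding W_def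
    by (auto intro!: span_mono)
  then have mem: "U1 \<in> A" "U3 \<in> A" "U2 \<in> A'" "U1 \<in> Y" "U2 \<in> Y"
    using U\<Omega> by (auto simp: A_def A'_def Y_def)
  have e0: "e 0 \<in> M" "f 0 \<in> U3" "B (e 0) (f 0) \<noteq> 0"
    using h k unfolding Me U3_def by (auto simp: hyperbolic_def intro: span_base)
  then have "\<not> U3 \<subseteq> M"
    using M(1) by (auto simp: isotropic_def)
  then have U3: "U3 \<notin> Y" "U1 \<noteq> U3"
    using mem by (auto simp: Y_def)
  have U12: "U1 \<noteq> U2" "U2 \<notin> A"
    using mem disjoint by auto
  have "\<not> trivial_multiset ?\<Omega> X"
  proof -
    have "X U1 = 2" "X U3 = 2" "X U2 = 0"
      using mem U12 by (auto simp: X_def)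
    then show ?thesis
      unfolding trivial_multiset_def using U\<Omega> U3(2) by (intro notI, elim disjE exE ex1E) (metis zero_neq_numeral)+
  qed
  moreover have "\<not> trivial_multiset ?\<Omega> (char_fun Y)"
  proof -
    have "char_fun Y U1 = 1" "char_fun Y U2 = 1" "char_fun Y U3 = 0"
      using mem U3 by (auto simp: char_fun_def)
    then show ?thesis
      unfolding trivial_multiset_def using U\<Omega> U12(1) by (intro notI, elim disjE exE ex1E) (metis zero_neq_one)+
  qed
  moreover have "Y \<subseteq> ?\<Omega>" by (auto simp: Y_def)
  ultimately show ?thesis
    unfolding non_spreading_def using finU[of ?\<Omega>] sum\<Omega> sumY
    by (intro conjI exI[of _ X] exI[of _ Y] exI[of _ "card Y"]) auto
qed

end

section \<open>Semisimilarities\<close>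

lemma field_automorphism_zero: "field_automorphism \<tau> \<Longrightarrow> \<tau> 0 = 0"
  unfolding field_automorphism_def by (metis add.right_neutral add_left_cancel)

lemma field_automorphism_id: "field_automorphism id"
  by (simp add: field_automorphism_def)

lemma field_automorphism_inv:
  assumes \<tau>: "field_automorphism \<tau>"
  shows "field_automorphism (inv_into UNIV \<tau>)"
proof -
  have bij: "bij \<tau>" and one: "\<tau> 1 = 1"
    and add: "\<tau> (x + y) = \<tau> x + \<tau> y" and mult: "\<tau> (x * y) = \<tau> x * \<tau> y" for x y
    using \<tau> by (auto simp: field_automorphism_def)
  have inj: "inv_into UNIV \<tau> (\<tau> x) = x" and surj: "\<tau> (inv_into UNIV \<tau> x) = x" for x
    using bij by (simp_all add: bij_is_inj bij_is_surj surj_f_inv_f)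
  have "inv_into UNIV \<tau> (x + y) = inv_into UNIV \<tau> x + inv_into UNIV \<tau> y"
    "inv_into UNIV \<tau> (x * y) = inv_into UNIV \<tau> x * inv_into UNIV \<tau> y" for x y
    using inj[of "inv_into UNIV \<tau> x + inv_into UNIV \<tau> y"]
      inj[of "inv_into UNIV \<tau> x * inv_into UNIV \<tau> y"] by (simp_all add: add mult surj)
  then show ?thesis
    using bij_imp_bij_inv[OF bij] inj[of 1] one by (simp add: field_automorphism_def)
qed

lemma semisimilaritiesE:
  assumes "g \<in> semisimilarities scale F"
  obtains \<tau> c where "bij g" "\<And>u v. g (u + v) = g u + g v" "field_automorphism \<tau>" "c \<noteq> 0"
    "\<And>a v. g (scale a v) = scale (\<tau> a) (g v)" "scales_form F \<tau> c g"
  using assms unfolding semisimilarities_def by blast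

lemma bij_semisimilarity: "g \<in> semisimilarities scale F \<Longrightarrow> bij g"
  by (simp add: semisimilarities_def)

lemma inv_semisimilarity:
  assumes "g \<in> semisimilarities scale F"
  shows "inv_into UNIV g \<in> semisimilarities scale F"
  using assms
proof (rule semisimilaritiesE)
  fix \<tau> c assume bij: "bij g" and add: "\<And>u v. g (u + v) = g u + g v"
    and \<tau>: "field_automorphism \<tau>" and c: "c \<noteq> 0"
    and scale: "\<And>a v. g (scale a v) = scale (\<tau> a) (g v)" and form: "scales_form F \<tau> c g"
  let ?h = "inv_into UNIV g" and ?\<tau> = "inv_into UNIV \<tau>"
  have inj: "?h (g x) = x" and surj: "g (?h x) = x" for x
    using bij by (simp_all add: bij_is_inj bij_is_surj surj_f_inv_f)
  have \<tau>bij: "bij \<tau>" using \<tau> by (simp add: field_automorphism_def)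
  have \<tau>inj: "?\<tau> (\<tau> x) = x" and \<tau>surj: "\<tau> (?\<tau> x) = x" for x
    using \<tau>bij by (simp_all add: bij_is_inj bij_is_surj surj_f_inv_f)
  have \<tau>': "field_automorphism ?\<tau>" by (rule field_automorphism_inv[OF \<tau>])
  have \<tau>mult: "?\<tau> (x * y) = ?\<tau> x * ?\<tau> y" for x y
    using \<tau>' by (simp add: field_automorphism_def)
  have "?h (u + v) = ?h u + ?h v" for u v
    using inj[of "?h u + ?h v"] by (simp add: add surj)
  moreover have "?h (scale a v) = scale (?\<tau> a) (?h v)" for a v
    using inj[of "scale (?\<tau> a) (?h v)"] by (simp add: scale surj \<tau>surj)
  moreover have "?\<tau> (1 / c) \<noteq> 0"
    using c field_automorphism_zero[OF \<tau>] \<tau>surj[of "1 / c"] by auto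
  \<comment> \<open>Solving \<open>x = c * \<tau> y\<close> for \<open>y\<close> shows that the
    inverse map scales the form by \<open>?\<tau> (1 / c)\<close>, with the inverse
    automorphism.\<close>
  moreover have solve: "y = ?\<tau> (1 / c) * ?\<tau> x" if "x = c * \<tau> y" for x y
    using c \<tau>inj[of y] that by (simp flip: \<tau>mult)
  have "scales_form F ?\<tau> (?\<tau> (1 / c)) ?h"
  proof (cases F)
    case (Alternating B)
    then have "B u v = c * \<tau> (B (?h u) (?h v))" for u v
      using form surj[of u] surj[of v] by (metis scales_form.simps(1))
    from solve[OF this] show ?thesis
      using Alternating by simp
  next
    case (Hermitian B)
    then have "B u v = c * \<tau> (B (?h u) (?h v))" for u v
      using form surj[of u] surj[of v] by (metis scales_form.simps(2))
    from solve[OF this] show ?thesis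
      using Hermitian by simp
  next
    case (Quadratic Q)
    then have "Q v = c * \<tau> (Q (?h v))" for v
      using form surj[of v] by (metis scales_form.simps(3))
    from solve[OF this] show ?thesis
      using Quadratic by simp
  qed
  ultimately show ?thesis
    using bij_imp_bij_inv[OF bij] \<tau>' unfolding semisimilarities_def by blast
qed

text \<open>The automorphism of the outer map also acts on the scalar of the inner one, so the
  composite has the scalar \<open>c * \<tau> c'\<close>.\<close>

lemma comp_semisimilarity:
  assumes "g \<in> semisimilarities scale F" "h \<in> semisimilarities scale F"
  shows "g \<circ> h \<in> semisimilarities scale F"
proof -
  obtain \<tau> c where g: "bij g" "\<And>u v. g (u + v) = g u + g v" "field_automorphism \<tau>" "c \<noteq> 0"
    "\<And>a v. g (scale a v) = scale (\<tau> a) (g v)" "scales_form F \<tau> c g"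
    using assms(1) by (rule semisimilaritiesE) blast
  obtain \<tau>' c' where h: "bij h" "\<And>u v. h (u + v) = h u + h v" "field_automorphism \<tau>'" "c' \<noteq> 0"
    "\<And>a v. h (scale a v) = scale (\<tau>' a) (h v)" "scales_form F \<tau>' c' h"
    using assms(2) by (rule semisimilaritiesE) blast
  have \<tau>: "bij \<tau>" "\<tau> (x * y) = \<tau> x * \<tau> y" for x y
    using g(3) by (auto simp: field_automorphism_def)
  have "\<tau> c' \<noteq> 0"
    using h(4) field_automorphism_zero[OF g(3)] \<tau>(1) by (metis bij_is_inj injD)
  moreover have "scales_form F (\<tau> \<circ> \<tau>') (c * \<tau> c') (g \<circ> h)"
    using g(6) h(6) by (cases F) (auto simp: \<tau>(2) mult.assoc)
  moreover have "field_automorphism (\<tau> \<circ> \<tau>')"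
    using g(3) h(3) by (auto simp: field_automorphism_def bij_comp)
  ultimately show ?thesis
    using g h unfolding semisimilarities_def
    by (intro CollectI conjI exI[of _ "\<tau> \<circ> \<tau>'"] exI[of _ "c * \<tau> c'"]) (auto intro: bij_comp)
qed

lemma isometry_semisimilarity:
  assumes "bij g" "\<And>u v. g (u + v) = g u + g v" "\<And>a u. g (scale a u) = scale a (g u)"
    and "scales_form F id 1 g"
  shows "g \<in> semisimilarities scale F"
  using assms field_automorphism_id unfolding semisimilarities_def
  by (intro CollectI conjI exI[of _ id] exI[of _ 1]) auto

lemma id_semisimilarity: "id \<in> semisimilarities scale F"
  by (rule isometry_semisimilarity) (cases F; simp)+

section \<open>Action of semisimilarities on subspaces\<close>

lemma vanishes_on_semisimilarity:
  assumes "g \<in> semisimilarities scale F" "vanishes_on F U"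
  shows "vanishes_on F (g ` U)"
  using assms(1)
proof (rule semisimilaritiesE)
  fix \<tau> c assume "field_automorphism \<tau>" "scales_form F \<tau> c g"
  then show ?thesis
    using assms(2) by (cases F) (simp_all add: field_automorphism_zero)
qed

lemma (in vector_space) subspace_semisimilarity:
  assumes g: "g \<in> semisimilarities scale F" and U: "subspace U"
  shows "subspace (g ` U)"
  using g
proof (rule semisimilaritiesE)
  fix \<tau> c assume add: "\<And>u v. g (u + v) = g u + g v"
    and \<tau>: "field_automorphism \<tau>" and scale: "\<And>a v. g (scale a v) = scale (\<tau> a) (g v)"
  have zero: "g 0 = 0" using add[of 0 0] by (metis add.right_neutral add_left_cancel)
  show ?thesis
  proof (rule subspaceI)
    show "0 \<in> g ` U" using zero subspace_0[OF U] by (metis imageI)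
  next
    fix x y assume "x \<in> g ` U" "y \<in> g ` U"
    then show "x + y \<in> g ` U"
      using subspace_add[OF U] by (auto simp flip: add)
  next
    fix a x assume "x \<in> g ` U"
    then obtain u where u: "u \<in> U" "x = g u" by auto
    obtain b where "a = \<tau> b"
      using \<tau> by (metis field_automorphism_def bij_is_surj surjE)
    then have "scale a x = g (scale b u)" using scale u by simp
    then show "scale a x \<in> g ` U"
      using subspace_scale[OF U u(1)] by blast
  qed
qed

text \<open>The images of a basis of \<open>S\<close> span a space containing the image of
  \<open>S\<close>: pulled back along the inverse, that span is a subspace containing the basis. So
  the dimension cannot grow, and applying this to the inverse map gives equality.\<close>

lemma (in finite_dimensional_vector_space) dim_semisimilarity:
  assumes g: "g \<in> semisimilarities scale F"
  shows "dim (g ` U) = dim U"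
proof -
  have le: "dim (h ` S) \<le> dim S" if h: "h \<in> semisimilarities scale F" for h S
  proof -
    obtain C where C: "C \<subseteq> S" "independent C" "S \<subseteq> span C" "card C = dim S"
      using basis_exists by blast
    have fin: "finite C" using C(2) by (rule finiteI_independent)
    have "subspace (inv_into UNIV h ` span (h ` C))"
      by (rule subspace_semisimilarity[OF inv_semisimilarity[OF h]]) simp
    moreover have "C \<subseteq> inv_into UNIV h ` span (h ` C)"
      using bij_semisimilarity[OF h] span_superset[of "h ` C"]
      by (force simp: bij_is_inj inv_f_f image_iff)
    ultimately have "S \<subseteq> inv_into UNIV h ` span (h ` C)"
      using C(3) span_minimal by blast
    then have "h ` S \<subseteq> span (h ` C)"
      using bij_semisimilarity[OF h] by (force simp: bij_is_surj surj_f_inv_f)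
    then have "dim (h ` S) \<le> card (h ` C)"
      using fin by (intro dim_le_card) auto
    also have "\<dots> \<le> dim S"
      using card_image_le[OF fin, of h] C(4) by simp
    finally show ?thesis .
  qed
  have "inv_into UNIV g ` g ` U = U"
    using bij_semisimilarity[OF g] by (simp add: bij_is_inj image_inv_f_f)
  then show ?thesis
    using le[OF g, of U] le[OF inv_semisimilarity[OF g], of "g ` U"] by simp
qed

text \<open>Every vector in the span of \<open>insert x S\<close> is given by a scalar and a vector
  of \<open>span S\<close>, so finiteness persists over a finite field.\<close>

lemma (in vector_space) finite_span:
  assumes "finite (UNIV :: 'a set)" "finite S"
  shows "finite (span S)"
  using assms(2)
proof induction
  case (insert x S)
  have "span (insert x S) \<subseteq> (\<lambda>(k, y). y + scale k x) ` (UNIV \<times> span S)"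
  proof
    fix z assume "z \<in> span (insert x S)"
    then obtain k where "z - scale k x \<in> span S"
      by (auto simp: span_insert)
    then show "z \<in> (\<lambda>(k, y). y + scale k x) ` (UNIV \<times> span S)"
      by (intro image_eqI[of _ _ "(k, z - scale k x)"]) auto
  qed
  then show ?case
    using insert assms(1) by (meson finite_SigmaI finite_imageI finite_subset)
qed simp

section \<open>The three kinds of forms as polar spaces\<close>

lemma polar_space_alternating:
  assumes fd: "finite_dimensional_vector_space scale Basis"
    and B: "alternating_form scale B" "nondegenerate (Alternating B)"
  shows "polar_space scale Basis B (\<lambda>_. 0) id (\<lambda>_. 0) (- 1)"
proof -
  have B': "B (u + v) w = B u w + B v w" "B (scale a u) w = a * B u w" "B w (u + v) = B w u + B w v"
    "B v v = 0" for u v w a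
    using B(1) by (auto simp: alternating_form_def bilinear_form_def Vector_Spaces.linear_iff)
  have "B (u + v) (u + v) = B u v + B v u" for u v
    by (simp add: B'(1,3)) (simp add: B'(4))
  then have swap: "B v u = - B u v" for u v
    by (simp add: B'(4) eq_neg_iff_add_eq_0 add.commute)
  show ?thesis
  proof (intro polar_space.intro polar_space_axioms.intro fd)
    show "B v u = - 1 * id (B u v)" for u v
      using swap[of v u] by simp
  qed (use B(2) in \<open>auto simp: B'\<close>)
qed

lemma polar_space_quadratic:
  assumes fd: "finite_dimensional_vector_space scale Basis"
    and Q: "quadratic_form scale Q" "nondegenerate (Quadratic Q)"
  shows "polar_space scale Basis (polar_form Q) Q id id 1"
proof -
  have B: "polar_form Q (u + v) w = polar_form Q u w + polar_form Q v w"
    "polar_form Q (scale a u) w = a * polar_form Q u w" "Q (scale a u) = a\<^sup>2 * Q u" for u v w a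
    using Q(1) by (auto simp: quadratic_form_def bilinear_form_def Vector_Spaces.linear_iff)
  interpret vector_space scale
    using fd by (simp add: finite_dimensional_vector_space_def)
  \<comment> \<open>Comparing \<open>Q (u + u) = 4 * Q u\<close> with the definition of the polar
    form works in every characteristic.\<close>
  have self: "polar_form Q u u = 0" if "Q u = 0" for u
  proof -
    have "u + u = scale 2 u"
      using scale_left_distrib[of 1 1 u] by simp
    then show ?thesis
      using that B(3)[of 2 u] by (simp add: polar_form_def)
  qed
  show ?thesis
  proof (intro polar_space.intro polar_space_axioms.intro fd)
    show "\<exists>c. Q u + id c = 0" for u
      by (rule exI[of _ "- Q u"]) simp
    show "Q (u + v) = Q u + Q v + id (polar_form Q u v)"
      "polar_form Q v u = 1 * id (polar_form Q u v)" for u v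
      by (simp_all add: polar_form_def add.commute)
  qed (use Q(2) self in \<open>auto simp: B power2_eq_square\<close>)
qed

lemma polar_space_hermitian:
  assumes fd: "finite_dimensional_vector_space scale Basis"
    and B: "hermitian_form scale B" "nondegenerate (Hermitian B)"
  obtains \<sigma> where "polar_space scale Basis B (\<lambda>v. B v v) \<sigma> (\<lambda>x. x + \<sigma> x) 1"
proof -
  obtain \<sigma> where \<sigma>: "field_automorphism \<sigma>" "\<sigma> \<noteq> id" "\<sigma> \<circ> \<sigma> = id"
    and lin: "\<And>v. Vector_Spaces.linear scale (*) (\<lambda>u. B u v)"
    and swap: "\<And>u v. B v u = \<sigma> (B u v)"
    using B(1) unfolding hermitian_form_def by blast
  have add: "\<sigma> (x + y) = \<sigma> x + \<sigma> y" and mult: "\<sigma> (x * y) = \<sigma> x * \<sigma> y" and one: "\<sigma> 1 = 1"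
    and invol: "\<sigma> (\<sigma> x) = x" for x y
    using \<sigma>(1,3) by (auto simp: field_automorphism_def fun_eq_iff)
  have B': "B (u + v) w = B u w + B v w" "B (scale a u) w = a * B u w" for u v w a
    using lin by (auto simp: Vector_Spaces.linear_iff)
  have B'': "B w (u + v) = B w u + B w v" "B w (scale a u) = \<sigma> a * B w u" for u v w a
    by (simp_all add: swap[of w] B' add mult)
  \<comment> \<open>The trace of \<open>\<sigma>\<close> is not identically zero: otherwise
    \<open>a = 1\<close> would force characteristic 2, and then \<open>\<sigma>\<close> would be the
    identity.\<close>
  have "\<exists>a. a + \<sigma> a \<noteq> 0"
  proof (rule ccontr)
    assume "\<not> (\<exists>a. a + \<sigma> a \<noteq> 0)"
    then have neg: "a = - \<sigma> a" for a
      by (simp add: eq_neg_iff_add_eq_0)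
    then have "- 1 = (1 :: 'a)" using one by metis
    then have "\<sigma> a = a" for a
      using neg[of a] by (metis mult_minus1 mult_1)
    then show False using \<sigma>(2) by auto
  qed
  then obtain a where a: "a + \<sigma> a \<noteq> 0" by blast
  have trace: "\<exists>c. B u u + (c + \<sigma> c) = 0" for u
  proof -
    \<comment> \<open>Both \<open>B u u\<close> and the trace of \<open>a\<close> are fixed by
      \<open>\<sigma>\<close>, hence so is \<open>d\<close>. The trace of \<open>d * a\<close> is
      then \<open>d\<close> times that of \<open>a\<close>, which is \<open>- B u u\<close>.\<close>
    define d where "d = - B u u / (a + \<sigma> a)"
    have d: "d * (a + \<sigma> a) = - B u u" using a by (simp add: d_def)
    have "\<sigma> (B u u) = B u u" using swap[of u u] by simp
    moreover have "\<sigma> (- x) = - \<sigma> x" for x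
      using add[of x "- x"] field_automorphism_zero[OF \<sigma>(1)] by (simp add: eq_neg_iff_add_eq_0 add.commute)
    ultimately have "\<sigma> d * (a + \<sigma> a) = - B u u"
      using arg_cong[OF d, of \<sigma>] by (simp add: mult add invol add.commute)
    then have "\<sigma> d = d" using a d by (metis mult_right_cancel)
    then have "B u u + (d * a + \<sigma> (d * a)) = 0"
      using d by (simp add: mult distrib_left)
    then show ?thesis by blast
  qed
  have "polar_space scale Basis B (\<lambda>v. B v v) \<sigma> (\<lambda>x. x + \<sigma> x) 1"
  proof (intro polar_space.intro polar_space_axioms.intro fd trace)
    show "B v u = 1 * \<sigma> (B u v)" for u v
      using swap[of v u] by simp
    show "B (u + v) (u + v) = B u u + B v v + (B u v + \<sigma> (B u v))" for u v
      using swap[of v u] by (simp add: B' B'')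
  qed (use B(2) in \<open>auto simp: B' B'' add mult one invol\<close>)
  then show ?thesis by (rule that)
qed

text \<open>Packages the three cases so that the main proof never inspects \<open>F\<close>: total
  isotropy and isometries are expressed through \<open>B\<close> and \<open>N\<close> alone.\<close>

lemma formed_space_polar_space:
  assumes fd: "finite_dimensional_vector_space scale Basis"
    and F: "form_on scale F" "nondegenerate F"
  obtains B N \<sigma> T \<epsilon> where "polar_space scale Basis B N \<sigma> T \<epsilon>"
    and "\<forall>U. module.subspace scale U \<longrightarrow>
      vanishes_on F U = ((\<forall>u\<in>U. N u = 0) \<and> (\<forall>u\<in>U. \<forall>v\<in>U. B u v = 0))"
    and "\<forall>g. (\<forall>u v. B (g u) (g v) = B u v) \<and> (\<forall>u. N (g u) = N u) \<longrightarrow> scales_form F id 1 g"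
proof (cases F)
  case (Alternating B)
  then show ?thesis
    using that[OF polar_space_alternating[OF fd, of B]] F by simp
next
  case (Hermitian B)
  then obtain \<sigma> where "polar_space scale Basis B (\<lambda>v. B v v) \<sigma> (\<lambda>x. x + \<sigma> x) 1"
    using polar_space_hermitian[OF fd, of B] F by auto
  from that[OF this] Hermitian show ?thesis by auto
next
  case (Quadratic Q)
  interpret vector_space scale
    using fd by (simp add: finite_dimensional_vector_space_def)
  \<comment> \<open>\<open>vanishes_on\<close> only mentions \<open>Q\<close> here. On a subspace,
    sums of singular vectors are singular, so the polar form vanishes too.\<close>
  have "polar_form Q u v = 0" if "subspace U" "\<forall>u\<in>U. Q u = 0" "u \<in> U" "v \<in> U" for U u v
    using that subspace_add[of U u v] by (simp add: polar_form_def)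
  with Quadratic show ?thesis
    using that[OF polar_space_quadratic[OF fd, of Q]] F by auto
qed

theorem theorem5p2:
  fixes scale :: "'a::{field,finite} \<Rightarrow> 'v::ab_group_add \<Rightarrow> 'v"
    and F :: "('a, 'v) form"
    and r :: nat
  assumes "r \<ge> 2" and "even r"
    and "formed_space scale F"
    and "vector_space.dim scale UNIV = 2 * r"
    and "witt_index scale F = r"
  shows "non_spreading (isotropic_subspaces scale F (r div 2))
           (induced_on_subsets (isotropic_subspaces scale F (r div 2)) (semisimilarities scale F))"
proof -
  obtain S where vs: "vector_space scale" and S: "finite S" "module.span scale S = UNIV"
    and F: "form_on scale F" "nondegenerate F"
    using assms(3) by (auto simp: formed_space_def)
  interpret vector_space scale by (rule vs)
  obtain Basis where Basis: "independent Basis" "UNIV \<subseteq> span Basis"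
    using basis_exists[of UNIV] by blast
  have fd: "finite_dimensional_vector_space scale Basis"
    using Basis independent_span_bound[OF S(1) Basis(1)] S(2) by unfold_locales auto
  obtain B N \<sigma> T \<epsilon> where "polar_space scale Basis B N \<sigma> T \<epsilon>"
    and vanish: "\<forall>U. subspace U \<longrightarrow>
      vanishes_on F U = ((\<forall>u\<in>U. N u = 0) \<and> (\<forall>u\<in>U. \<forall>v\<in>U. B u v = 0))"
    and isometry: "\<forall>g. (\<forall>u v. B (g u) (g v) = B u v) \<and> (\<forall>u. N (g u) = N u) \<longrightarrow> scales_form F id 1 g"
    using that by (rule formed_space_polar_space[OF fd F])
  then interpret polar_space scale Basis B N \<sigma> T \<epsilon> by simp
  have iso: "totally_isotropic scale F U \<longleftrightarrow> isotropic U" for U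
    using vanish by (auto simp: totally_isotropic_def isotropic_def)
  interpret polar_space_group scale Basis B N \<sigma> T \<epsilon> "semisimilarities scale F"
  proof
    show "isotropic (g ` U)" if "g \<in> semisimilarities scale F" "isotropic U" for g U
      using that subspace_semisimilarity vanishes_on_semisimilarity
      by (auto simp: totally_isotropic_def simp flip: iso)
    show "g \<in> semisimilarities scale F"
      if "bij g" "\<And>u v. g (u + v) = g u + g v" "\<And>a u. g (scale a u) = scale a (g u)"
        "\<And>u v. B (g u) (g v) = B u v" "\<And>u. N (g u) = N u" for g
      using that isometry by (intro isometry_semisimilarity) auto
  qed (simp_all add: bij_semisimilarity inv_semisimilarity comp_semisimilarity id_semisimilarity
      dim_semisimilarity)
  \<comment> \<open>\<open>witt_index\<close> is a \<open>Max\<close>; finiteness and nonemptiness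
    of the set of dimensions guarantee an isotropic \<open>M\<close> that attains it.\<close>
  have "finite {dim U | U. isotropic U}"
    by (rule finite_subset[of _ "{..dim UNIV}"]) (auto intro: dim_subset simp del: dim_UNIV)
  moreover have "isotropic {0}"
    by (simp add: isotropic_def)
  ultimately have "Max {dim U | U. isotropic U} \<in> {dim U | U. isotropic U}"
    by (intro Max_in) auto
  then obtain M where "isotropic M" "dim M = r"
    using assms(5) by (auto simp: witt_index_def iso)
  moreover have "finite (UNIV :: 'v set)"
    using finite_span[OF _ S(1)] S(2) by simp
  moreover obtain k where "r = 2 * k"
    using assms(2) by blast
  ultimately have "non_spreading (isotropics k) (induced_on_subsets (isotropics k) (semisimilarities scale F))"
    using assms(1,4) by (intro non_spreading_isotropics) auto
  moreover have "isotropic_subspaces scale F (r div 2) = isotropics k"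
    using \<open>r = 2 * k\<close> by (simp add: isotropic_subspaces_def isotropics_def iso)
  ultimately show ?thesis by simp
qed

end
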